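(* Let $D$ be a $p\mathcal{BC}+$ action description with utility laws satisfying the standing assumptions, let $m$ be a nonnegative integer, and let $s_0\in\mathbf{S}$ be an initial state that is consistent with $D_{init}$. For any non-stationary policy $\pi$ and any finite state sequence $\mathbf{s}=\langle s_0,s_1,\dots,s_{m-1},s_m\rangle$ with each $s_i\in\mathbf{S}$ ($i\in\{0,\dots,m\}$), we have: (1) $R_D(\mathbf{h}_\pi(\mathbf{s}))=R_{M(D)}(\mathbf{h}_\pi(\mathbf{s}))$; (2) $P_{Tr(D,m)}(\mathbf{s}^t\mid\langle s_0\rangle^t\wedge C_{\pi,m})=P_{M(D)}(\mathbf{h}_\pi(\mathbf{s}))$.
   Context: Stable models. Formulas are propositional. A rule $F\leftarrow G$ is the implication $G\rightarrow F$; $\neg F$ is $F\rightarrow\bot$; the choice rule $\{A\}^{ch}$ for an atom $A$ is $A\leftarrow\neg\neg A$. An interpretation is identified with the set of atoms true in it. $I$ is a stable model of a finite set $\Pi$ of formulas if $I$ is a minimal (w.r.t. inclusion) model of the reduct $\Pi^I$ obtained by replacing every maximal subformula not satisfied by $I$ by $\bot$. LP$^{MLN}$. An LP$^{MLN}$ program $\Pi$ is a finite set of weighted rules $w:R$, with $w$ real (soft) or $w=\alpha$ (hard). $\Pi_I$ is the set of $w:R$ in $\Pi$ with $I\models R$. $SM[\Pi]$ is the set of $I$ that are stable models of $\Pi_I$ (weights dropped) and satisfy all hard rules; its elements are called the (probabilistic) stable models of $\Pi$. $W_\Pi(I)=\exp(\sum_{w:R\in\Pi_I}w)$ for $I\in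 SM[\Pi]$ and $0$ otherwise (all hard rules are satisfied by every $I\in SM[\Pi]$, so their common infinite weight cancels and only soft rules matter for probabilities); $P_\Pi(I)=W_\Pi(I)/\sum_{J\in SM[\Pi]}W_\Pi(J)$. For a formula $F$, $P_\Pi(F)=\sum_{I\models F}P_\Pi(I)$, and $P_\Pi(F\mid G)=P_\Pi(F\wedge G)/P_\Pi(G)$. Utility atoms are atoms $\mathtt{utility}(u,\mathbf{t})$ with $u$ real and $\mathbf t$ a list of terms. $U_\Pi(I)=\sum_{\mathtt{utility}(u,\mathbf{t})\in I}u$, and for a formula $A$, $E[U_\Pi(A)]=\sum_{I\models A}U_\Pi(I)\,P_\Pi(I\mid A)$. Multi-valued probabilistic programs. Each constant $c$ has a finite domain $Dom(c)$; atoms are $c=v$, $v\in Dom(c)$. Boolean constants have domain $\{\text{true},\text{false}\}$. A multi-valued probabilistic program $\langle PF,\Pi\rangle$ consists of declarations $p_1::c=v_1\mid\dots\mid p_n::c=v_n$ (one for each probabilistic constant $c$) and rules $\Pi$ whose heads contain no probabilistic constants. When all $0<p_i<1$ (as is the case below), it abbreviates the LP$^{MLN}$ program with soft rules $\ln(p_i):c=v_i$, hard rules for all of $\Pi$, and, for every constant $c$, hard constraints saying that $c$ has at most one value ($\bot\leftarrow c=v\wedge c=v'$ for $v\ne v'$) and at least one value ($\bot\leftarrow\neg\bigvee_v c=v$). $p\mathcal{BC}+$. Constants are divided into fluent constants $\sigma^{fl}$ (regular or statically determined), Boolean action constants $\sigma^{act}$, pf constants $\sigma^{pf}$ and initpf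 constants $\sigma^{initpf}$. Fluent formulas contain only fluent constants. An action description $D$ is a finite set of: static laws "caused $F$ if $G$" ($F,G$ fluent formulas); fluent dynamic laws "caused $F$ if $G$ after $H$" ($F,G$ fluent formulas, $F$ without statically determined constants, $H$ a formula without initpf constants); for each pf and each initpf constant $c$, a declaration "caused $c=\{v_1:p_1,\dots,v_n:p_n\}$" with $Dom(c)=\{v_1,\dots,v_n\}$, $0<p_i<1$, $\sum p_i=1$; initial static laws "initially $F$ if $G$" ($F$ a fluent atom, $G$ without action or pf constants); utility laws "reward $v$ if $F$ after $G$" ($v$ real, $F$ a fluent formula, $G$ containing only fluent and action constants). $i:F$ is $F$ with every constant $c$ replaced by the time-stamped constant $i:c$ (similarly for interpretations and sets). For $m\ge0$, $D_m$ is the multi-valued probabilistic program over the constants $i:c$ ($0\le i\le m$ for fluent $c$; $0\le i\le m-1$ for action and pf $c$) consisting of: $i:F\leftarrow i:G$ for each static law, $0\le i\le m$; $i{+}1:F\leftarrow(i{+}1:G)\wedge(i:H)$ for each fluent dynamic law, $0\le i\le m-1$; $\{0:c=v\}^{ch}$ for each regular fluent constant $c$ and $v\in Dom(c)$; $\{i:c=\text{true}\}^{ch}$, $\{i:c=\text{false}\}^{ch}$ for each action constant $c$, $0\le i\le m-1$; $p_1::i:c=v_1\mid\dots\mid p_n::i:c=v_n$ for each pf declaration, $0\le i\le m-1$; and the hard rules $\mathtt{utility}(v,i{+}1,id)\leftarrow(i{+}1:F)\wedge(i:G)$ for each utility law, $0\le i\le m-1$, where $id$ is a number unique to the rule. $D_{init}$,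 over $0:\sigma^{initpf}\cup0:\sigma^{fl}$, is the multi-valued probabilistic program consisting of $\bot\leftarrow\neg(0:F)\wedge0:G$ for each initial static law and $p_1::0:c=v_1\mid\dots\mid p_n::0:c=v_n$ for each initpf declaration. $Tr(D,m)$ is the union of $D_m$ and $D_{init}$. An interpretation of part of the signature is a residual stable model of a program if it extends to a stable model of it. A state is an interpretation $s$ of $\sigma^{fl}$ such that $0:s$ is a residual stable model of $D_0$; $\mathbf{S}$ is the set of states. $\mathbf{A}$ is the set of interpretations $a$ of $\sigma^{act}$ such that $0:a$ is a residual stable model of $D_1$. A transition is a triple $\langle s,e,s'\rangle$ such that $0:s\cup0:e\cup1:s'$ is a residual stable model of $D_1$; $(\langle s,e,s'\rangle,pf)$ is a pf-transition if, in addition, $pf$ is a value assignment to $\sigma^{pf}$ and $0:s\cup 0:e\cup1:s'\cup0:pf$ (together with the utility atoms it determines) is a stable model of $D_1$. Standing assumptions on $D$: (1) in every transition $\langle s,e,s'\rangle$ at most one action constant is true in $e$; (2) for every state $s$, every assignment $e$ to $\sigma^{act}$ with at most one action true, and every assignment $pf$ to $\sigma^{pf}$, there is exactly one state $s'$ such that $(\langle s,e,s'\rangle,pf)$ is a pf-transition; (3) for every assignment $pf_{init}$ of $\sigma^{initpf}$ there is exactly one assignment $fl$ of $\sigma^{fl}$ such that $0:pf_{init}\cup0:fl$ is a stable model of $D_{init}\cup D_0$. For a state $s$ (or $a\in\mathbf{A}$), $i:s$ (or $i:a$) as a formula is the conjunction of the atoms $i:c=v$ it makes true. $\langle s_0,\dots,s_m\rangle^t$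 is the formula $0:s_0\wedge\dots\wedge m:s_m$ (so $\langle s_0\rangle^t$ is $0:s_0$). For a history $\mathbf{h}=\langle s_0,a_0,s_1,\dots,a_{m-1},s_m\rangle$ ($s_i\in\mathbf{S}$, $a_i\in\mathbf{A}$), $\mathbf{h}^t$ is $0:s_0\wedge0:a_0\wedge1:s_1\wedge\dots\wedge m{-}1:a_{m-1}\wedge m:s_m$. A state $s$ is consistent with $D_{init}$ if there exists at least one probabilistic stable model $I$ of $D_{init}$ such that $I\models 0:s$. A (non-stationary) policy is a function $\pi:\mathbf{S}\times\{0,\dots,m-1\}\to\mathbf{A}$, and $C_{\pi,m}$ is the formula $\bigwedge_{s\in\mathbf{S},\,0\le i\le m-1}(i:s\rightarrow i:\pi(s,i))$. For $\mathbf{s}=\langle s_0,\dots,s_m\rangle$, $\mathbf{h}_\pi(\mathbf{s})=\langle s_0,\pi(s_0,0),s_1,\dots,\pi(s_{m-1},m-1),s_m\rangle$. The total reward of a history under $D$ is $R_D(\mathbf{h})=E[U_{Tr(D,m)}(\mathbf{h}^t)]$. MDP. $M(D)=\langle\mathbf{S},\mathbf{A},T,R\rangle$ with $T(s,a,s')=P_{D_1}(1:s'\mid0:s\wedge0:a)$ and $R(s,a,s')=E[U_{D_1}(0:s\wedge0:a\wedge1:s')]$. For a history $\mathbf{h}=\langle s_0,a_0,\dots,a_{m-1},s_m\rangle$, $R_{M(D)}(\mathbf{h})=\sum_{i=0}^{m-1}R(s_i,a_i,s_{i+1})$ and $P_{M(D)}(\mathbf{h})=\prod_{i=0}^{m-1}T(s_i,a_i,s_{i+1})$.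 *)

theory Defs
  imports Complex_Main
begin

section \<open>Propositional formulas and stable models\<close>

datatype 'a fm = Bot | Atom 'a | And "'a fm" "'a fm" | Or "'a fm" "'a fm" | Imp "'a fm" "'a fm"

abbreviation Neg :: "'a fm \<Rightarrow> 'a fm" where "Neg F \<equiv> Imp F Bot"
abbreviation Top :: "'a fm" where "Top \<equiv> Imp Bot Bot"

text \<open>\<open>rule F G\<close> is the rule written \<open>F \<leftarrow> G\<close>.\<close>
abbreviation rule :: "'a fm \<Rightarrow> 'a fm \<Rightarrow> 'a fm" where "rule F G \<equiv> Imp G F"
abbreviation choice :: "'a \<Rightarrow> 'a fm" where "choice A \<equiv> rule (Atom A) (Neg (Neg (Atom A)))"

definition conjs :: "'a fm list \<Rightarrow> 'a fm" where "conjs Fs = foldr And Fs Top"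
definition disjs :: "'a fm list \<Rightarrow> 'a fm" where "disjs Fs = foldr Or Fs Bot"

text \<open>An arbitrary but fixed enumeration of a finite set, used to write finite conjunctions and
  disjunctions indexed by sets; their satisfaction does not depend on it.\<close>
definition enum_of :: "'a set \<Rightarrow> 'a list" where
  "enum_of A = (SOME xs. set xs = A \<and> distinct xs)"

definition Conj :: "'a fm set \<Rightarrow> 'a fm" where "Conj A = conjs (enum_of A)"
definition Disj :: "'a fm set \<Rightarrow> 'a fm" where "Disj A = disjs (enum_of A)"

primrec sat :: "'a set \<Rightarrow> 'a fm \<Rightarrow> bool" where
  "sat I Bot = False"
| "sat I (Atom a) = (a \<in> I)"
| "sat I (And F G) = (sat I F \<and> sat I G)"
| "sat I (Or F G) = (sat I F \<or> sat I G)"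
| "sat I (Imp F G) = (sat I F \<longrightarrow> sat I G)"

primrec reduct :: "'a set \<Rightarrow> 'a fm \<Rightarrow> 'a fm" where
  "reduct I Bot = Bot"
| "reduct I (Atom a) = (if sat I (Atom a) then Atom a else Bot)"
| "reduct I (And F G) = (if sat I (And F G) then And (reduct I F) (reduct I G) else Bot)"
| "reduct I (Or F G) = (if sat I (Or F G) then Or (reduct I F) (reduct I G) else Bot)"
| "reduct I (Imp F G) = (if sat I (Imp F G) then Imp (reduct I F) (reduct I G) else Bot)"

definition stable_model :: "'a fm set \<Rightarrow> 'a set \<Rightarrow> bool" where
  "stable_model \<Pi> I \<longleftrightarrow>
     (\<forall>F\<in>\<Pi>. sat I (reduct I F)) \<and> (\<forall>J. J \<subset> I \<longrightarrow> \<not> (\<forall>F\<in>\<Pi>. sat J (reduct I F)))"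

lemma enum_of: "finite A \<Longrightarrow> set (enum_of A) = A \<and> distinct (enum_of A)"
  unfolding enum_of_def by (rule someI_ex) (rule finite_distinct_list)

lemma sat_conjs [simp]: "sat I (conjs Fs) \<longleftrightarrow> (\<forall>F\<in>set Fs. sat I F)"
  by (induction Fs) (auto simp: conjs_def)

lemma sat_disjs [simp]: "sat I (disjs Fs) \<longleftrightarrow> (\<exists>F\<in>set Fs. sat I F)"
  by (induction Fs) (auto simp: disjs_def)

lemma sat_Conj: "finite A \<Longrightarrow> sat I (Conj A) \<longleftrightarrow> (\<forall>F\<in>A. sat I F)"
  by (simp add: Conj_def enum_of)

lemma sat_Disj: "finite A \<Longrightarrow> sat I (Disj A) \<longleftrightarrow> (\<exists>F\<in>A. sat I F)"
  by (simp add: Disj_def enum_of)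

section \<open>Weighted programs\<close>

datatype weight = Soft real | Hard

type_synonym 'a lpmln = "(weight \<times> 'a fm) set"

definition sat_part :: "'a lpmln \<Rightarrow> 'a set \<Rightarrow> 'a lpmln" where
  "sat_part \<Pi> I = {(w, R) \<in> \<Pi>. sat I R}"

definition SM :: "'a lpmln \<Rightarrow> 'a set set" where
  "SM \<Pi> = {I. stable_model (snd ` sat_part \<Pi> I) I \<and> (\<forall>R. (Hard, R) \<in> \<Pi> \<longrightarrow> sat I R)}"

definition weight_of :: "'a lpmln \<Rightarrow> 'a set \<Rightarrow> real" where
  "weight_of \<Pi> I =
     (if I \<in> SM \<Pi> then exp (\<Sum>(w, R) | (Soft w, R) \<in> sat_part \<Pi> I. w) else 0)"

definition prob_int :: "'a lpmln \<Rightarrow> 'a set \<Rightarrow> real" where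
  "prob_int \<Pi> I = weight_of \<Pi> I / (\<Sum>J\<in>SM \<Pi>. weight_of \<Pi> J)"

text \<open>Interpretations outside \<open>SM \<Pi>\<close> have probability 0; summing over \<open>SM \<Pi>\<close> keeps the index
  set finite.\<close>
definition prob :: "'a lpmln \<Rightarrow> 'a fm \<Rightarrow> real" where
  "prob \<Pi> F = (\<Sum>I | I \<in> SM \<Pi> \<and> sat I F. prob_int \<Pi> I)"

text \<open>Conditional probabilities and expectations are undefined (\<open>None\<close>) when the condition has
  probability 0.\<close>
definition cond_prob :: "'a lpmln \<Rightarrow> 'a fm \<Rightarrow> 'a fm \<Rightarrow> real option" where
  "cond_prob \<Pi> F G = (if prob \<Pi> G = 0 then None else Some (prob \<Pi> (And F G) / prob \<Pi> G))"

text \<open>Atoms \<open>c = v\<close> and utility atoms; all terms occurring in utility atoms are numbers.\<close>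
datatype ('k, 'v) atm = Eq 'k 'v | Utility real "nat list"

definition utility :: "('k, 'v) atm set \<Rightarrow> real" where
  "utility I = (\<Sum>(u, t) | Utility u t \<in> I. u)"

definition expected_utility :: "('k, 'v) atm lpmln \<Rightarrow> ('k, 'v) atm fm \<Rightarrow> real option" where
  "expected_utility \<Pi> A =
     (if prob \<Pi> A = 0 then None
      else Some (\<Sum>I | I \<in> SM \<Pi> \<and> sat I A. utility I * (prob_int \<Pi> I / prob \<Pi> A)))"

section \<open>Multi-valued probabilistic programs\<close>

text \<open>Constants \<open>C\<close> with domains \<open>Dom\<close>, probabilistic constants \<open>PC\<close> with declarations \<open>p\<close>
  (strictly between 0 and 1), and rules \<open>\<Pi>\<close>.\<close>
definition mvpp :: "'k set \<Rightarrow> ('k \<Rightarrow> 'v set) \<Rightarrow> 'k set \<Rightarrow> ('k \<Rightarrow> 'v \<Rightarrow> real) \<Rightarrow>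
    ('k, 'v) atm fm set \<Rightarrow> ('k, 'v) atm lpmln" where
  "mvpp C Dom PC p \<Pi> =
     {(Soft (ln (p c v)), Atom (Eq c v)) | c v. c \<in> PC \<and> v \<in> Dom c}
   \<union> {(Hard, R) | R. R \<in> \<Pi>}
   \<union> {(Hard, rule Bot (And (Atom (Eq c v)) (Atom (Eq c v')))) | c v v'.
        c \<in> C \<and> v \<in> Dom c \<and> v' \<in> Dom c \<and> v \<noteq> v'}
   \<union> {(Hard, rule Bot (Neg (Disj ((\<lambda>v. Atom (Eq c v)) ` Dom c)))) | c. c \<in> C}"

section \<open>Action descriptions\<close>

datatype 'v val = BVal bool | Val 'v

type_synonym ('c, 'v) assign = "('c \<times> 'v val) set"
type_synonym ('c, 'v) law_fm = "('c \<times> 'v val) fm"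
type_synonym ('c, 'v) tatm = "(nat \<times> 'c, 'v val) atm"

text \<open>Laws are tuples of their components in reading order: \<open>(F, G)\<close> for ``caused F if G'',
  \<open>(F, G, H)\<close> for ``caused F if G after H'', \<open>((c, v), G)\<close> for ``initially c = v if G'' and
  \<open>(v, F, G)\<close> for ``reward v if F after G''.  The function \<open>decl\<close> gives the probabilities declared
  for pf and initpf constants, and \<open>uid\<close> the identifying number of a utility law.\<close>
record ('c, 'v) action_desc =
  regular :: "'c set"
  statdet :: "'c set"
  act :: "'c set"
  pf :: "'c set"
  initpf :: "'c set"
  vals :: "'c \<Rightarrow> 'v val set"
  static_laws :: "(('c, 'v) law_fm \<times> ('c, 'v) law_fm) set"
  dynamic_laws :: "(('c, 'v) law_fm \<times> ('c, 'v) law_fm \<times> ('c, 'v) law_fm) set"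
  decl :: "'c \<Rightarrow> 'v val \<Rightarrow> real"
  initial_laws :: "(('c \<times> 'v val) \<times> ('c, 'v) law_fm) set"
  utility_laws :: "(real \<times> ('c, 'v) law_fm \<times> ('c, 'v) law_fm) set"
  uid :: "(real \<times> ('c, 'v) law_fm \<times> ('c, 'v) law_fm) \<Rightarrow> nat"

definition fl :: "('c, 'v) action_desc \<Rightarrow> 'c set" where
  "fl D = regular D \<union> statdet D"

definition atoms_over :: "('c, 'v) action_desc \<Rightarrow> 'c set \<Rightarrow> ('c \<times> 'v val) set" where
  "atoms_over D C = {(c, v). c \<in> C \<and> v \<in> vals D c}"

definition fm_over :: "('c, 'v) action_desc \<Rightarrow> 'c set \<Rightarrow> ('c, 'v) law_fm \<Rightarrow> bool" where
  "fm_over D C F \<longleftrightarrow> set_fm F \<subseteq> atoms_over D C"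

definition action_description :: "('c, 'v) action_desc \<Rightarrow> bool" where
  "action_description D \<longleftrightarrow>
     finite (regular D) \<and> finite (statdet D) \<and> finite (act D) \<and> finite (pf D) \<and> finite (initpf D) \<and>
     regular D \<inter> statdet D = {} \<and> fl D \<inter> act D = {} \<and> fl D \<inter> pf D = {} \<and> fl D \<inter> initpf D = {} \<and>
     act D \<inter> pf D = {} \<and> act D \<inter> initpf D = {} \<and> pf D \<inter> initpf D = {} \<and>
     (\<forall>c \<in> fl D \<union> act D \<union> pf D \<union> initpf D. finite (vals D c)) \<and>
     (\<forall>c \<in> act D. vals D c = {BVal True, BVal False}) \<and>
     finite (static_laws D) \<and> finite (dynamic_laws D) \<and> finite (initial_laws D) \<and>
     finite (utility_laws D) \<and>
     (\<forall>(F, G) \<in> static_laws D. fm_over D (fl D) F \<and> fm_over D (fl D) G) \<and>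
     (\<forall>(F, G, H) \<in> dynamic_laws D. fm_over D (regular D) F \<and> fm_over D (fl D) G \<and>
        fm_over D (fl D \<union> act D \<union> pf D) H) \<and>
     (\<forall>c \<in> pf D \<union> initpf D. (\<forall>v \<in> vals D c. 0 < decl D c v \<and> decl D c v < 1) \<and>
        (\<Sum>v\<in>vals D c. decl D c v) = 1) \<and>
     (\<forall>(A, G) \<in> initial_laws D. A \<in> atoms_over D (fl D) \<and> fm_over D (fl D \<union> initpf D) G) \<and>
     (\<forall>(v, F, G) \<in> utility_laws D. fm_over D (fl D) F \<and> fm_over D (fl D \<union> act D) G) \<and>
     inj_on (uid D) (utility_laws D)"

abbreviation stamp_atom :: "nat \<Rightarrow> 'c \<times> 'v val \<Rightarrow> ('c, 'v) tatm" where
  "stamp_atom i A \<equiv> Eq (i, fst A) (snd A)"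

definition stamp_fm :: "nat \<Rightarrow> ('c, 'v) law_fm \<Rightarrow> ('c, 'v) tatm fm" where
  "stamp_fm i = map_fm (stamp_atom i)"

definition stamp :: "nat \<Rightarrow> ('c, 'v) assign \<Rightarrow> ('c, 'v) tatm set" where
  "stamp i s = stamp_atom i ` s"

definition D_m :: "('c, 'v) action_desc \<Rightarrow> nat \<Rightarrow> ('c, 'v) tatm lpmln" where
  "D_m D m = mvpp
     ({..m} \<times> fl D \<union> {..<m} \<times> (act D \<union> pf D))
     (\<lambda>(i, c). vals D c)
     ({..<m} \<times> pf D)
     (\<lambda>(i, c). decl D c)
     ({rule (stamp_fm i F) (stamp_fm i G) | i F G. i \<le> m \<and> (F, G) \<in> static_laws D}
    \<union> {rule (stamp_fm (i + 1) F) (And (stamp_fm (i + 1) G) (stamp_fm i H)) | i F G H.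
         i < m \<and> (F, G, H) \<in> dynamic_laws D}
    \<union> {choice (Eq (0, c) v) | c v. c \<in> regular D \<and> v \<in> vals D c}
    \<union> {choice (Eq (i, c) (BVal b)) | i c b. i < m \<and> c \<in> act D}
    \<union> {rule (Atom (Utility v [i + 1, uid D (v, F, G)]))
         (And (stamp_fm (i + 1) F) (stamp_fm i G)) | i v F G.
         i < m \<and> (v, F, G) \<in> utility_laws D})"

definition D_init :: "('c, 'v) action_desc \<Rightarrow> ('c, 'v) tatm lpmln" where
  "D_init D = mvpp
     ({0} \<times> (initpf D \<union> fl D))
     (\<lambda>(i, c). vals D c)
     ({0} \<times> initpf D)
     (\<lambda>(i, c). decl D c)
     {rule Bot (And (Neg (Atom (stamp_atom 0 A))) (stamp_fm 0 G)) | A G. (A, G) \<in> initial_laws D}"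

definition Tr :: "('c, 'v) action_desc \<Rightarrow> nat \<Rightarrow> ('c, 'v) tatm lpmln" where
  "Tr D m = D_m D m \<union> D_init D"

section \<open>States, actions, transitions\<close>

definition residual_stable_model :: "'a set \<Rightarrow> 'a set \<Rightarrow> 'a lpmln \<Rightarrow> bool" where
  "residual_stable_model sig J \<Pi> \<longleftrightarrow> (\<exists>I\<in>SM \<Pi>. I \<inter> sig = J)"

definition states :: "('c, 'v) action_desc \<Rightarrow> ('c, 'v) assign set" where
  "states D = {s. s \<subseteq> atoms_over D (fl D) \<and>
     residual_stable_model (stamp 0 (atoms_over D (fl D))) (stamp 0 s) (D_m D 0)}"

definition actions :: "('c, 'v) action_desc \<Rightarrow> ('c, 'v) assign set" where
  "actions D = {a. a \<subseteq> atoms_over D (act D) \<and>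
     residual_stable_model (stamp 0 (atoms_over D (act D))) (stamp 0 a) (D_m D 1)}"

definition transition ::
    "('c, 'v) action_desc \<Rightarrow> ('c, 'v) assign \<Rightarrow> ('c, 'v) assign \<Rightarrow> ('c, 'v) assign \<Rightarrow> bool" where
  "transition D s e s' \<longleftrightarrow>
     s \<subseteq> atoms_over D (fl D) \<and> e \<subseteq> atoms_over D (act D) \<and> s' \<subseteq> atoms_over D (fl D) \<and>
     residual_stable_model
       (stamp 0 (atoms_over D (fl D)) \<union> stamp 0 (atoms_over D (act D)) \<union> stamp 1 (atoms_over D (fl D)))
       (stamp 0 s \<union> stamp 0 e \<union> stamp 1 s') (D_m D 1)"

definition assigns :: "('c, 'v) action_desc \<Rightarrow> 'c set \<Rightarrow> ('c, 'v) assign set" where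
  "assigns D C = {s. s \<subseteq> atoms_over D C \<and> (\<forall>c\<in>C. \<exists>!v. (c, v) \<in> s)}"

definition pf_transition :: "('c, 'v) action_desc \<Rightarrow>
    ('c, 'v) assign \<Rightarrow> ('c, 'v) assign \<Rightarrow> ('c, 'v) assign \<Rightarrow> ('c, 'v) assign \<Rightarrow> bool" where
  "pf_transition D s e s' f \<longleftrightarrow>
     transition D s e s' \<and> f \<in> assigns D (pf D) \<and>
     (\<exists>X \<subseteq> {Utility u t | u t. True}.
        stamp 0 s \<union> stamp 0 e \<union> stamp 1 s' \<union> stamp 0 f \<union> X \<in> SM (D_m D 1))"

definition at_most_one_action :: "('c, 'v) assign \<Rightarrow> bool" where
  "at_most_one_action e \<longleftrightarrow> (\<forall>c c'. (c, BVal True) \<in> e \<longrightarrow> (c', BVal True) \<in> e \<longrightarrow> c = c')"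

definition standing_assumptions :: "('c, 'v) action_desc \<Rightarrow> bool" where
  "standing_assumptions D \<longleftrightarrow>
     (\<forall>s e s'. transition D s e s' \<longrightarrow> at_most_one_action e) \<and>
     (\<forall>s \<in> states D. \<forall>e \<in> assigns D (act D). \<forall>f \<in> assigns D (pf D).
        at_most_one_action e \<longrightarrow> (\<exists>!s'. s' \<in> states D \<and> pf_transition D s e s' f)) \<and>
     (\<forall>f \<in> assigns D (initpf D). \<exists>!g. g \<in> assigns D (fl D) \<and>
        stamp 0 f \<union> stamp 0 g \<in> SM (D_init D \<union> D_m D 0))"

definition at_time :: "nat \<Rightarrow> ('c, 'v) assign \<Rightarrow> ('c, 'v) tatm fm" where
  "at_time i s = Conj (Atom ` stamp i s)"

text \<open>In \<open>D_init\<close> alone no rule supports fluent atoms, so if there are fluents it has no stable models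
  at all.  As in the last standing assumption, the initial program is therefore
  taken together with \<open>D_m D 0\<close>; lemma \<open>consistent_initI\<close> below shows that for states this is
  implied by satisfaction in a stable model of \<open>D_init D\<close>.\<close>
definition consistent_init :: "('c, 'v) action_desc \<Rightarrow> ('c, 'v) assign \<Rightarrow> bool" where
  "consistent_init D s \<longleftrightarrow> (\<exists>I \<in> SM (D_init D \<union> D_m D 0). sat I (at_time 0 s))"

section \<open>Histories, policies and the induced decision process\<close>

text \<open>A history \<open>s\<^sub>0, a\<^sub>0, s\<^sub>1, \<dots>, a\<^sub>m\<^sub>-\<^sub>1, s\<^sub>m\<close> is a pair of functions, of which only
  the values at \<open>i \<le> m\<close> and \<open>i < m\<close>, respectively, are relevant.\<close>
type_synonym ('s, 'a) history = "(nat \<Rightarrow> 's) \<times> (nat \<Rightarrow> 'a)"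

definition seq_fm :: "nat \<Rightarrow> (nat \<Rightarrow> ('c, 'v) assign) \<Rightarrow> ('c, 'v) tatm fm" where
  "seq_fm m s = conjs (map (\<lambda>i. at_time i (s i)) [0..<m + 1])"

definition history_fm ::
    "nat \<Rightarrow> (('c, 'v) assign, ('c, 'v) assign) history \<Rightarrow> ('c, 'v) tatm fm" where
  "history_fm m = (\<lambda>(s, a).
     conjs (concat (map (\<lambda>i. [at_time i (s i), at_time i (a i)]) [0..<m]) @ [at_time m (s m)]))"

definition policy_fm :: "('c, 'v) action_desc \<Rightarrow> (('c, 'v) assign \<Rightarrow> nat \<Rightarrow> ('c, 'v) assign) \<Rightarrow>
    nat \<Rightarrow> ('c, 'v) tatm fm" where
  "policy_fm D \<pi> m =
     Conj {Imp (at_time i s) (at_time i (\<pi> s i)) | s i. s \<in> states D \<and> i < m}"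

definition policy_history :: "('s \<Rightarrow> nat \<Rightarrow> 'a) \<Rightarrow> (nat \<Rightarrow> 's) \<Rightarrow> ('s, 'a) history" where
  "policy_history \<pi> s = (s, \<lambda>i. \<pi> (s i) i)"

definition total_reward :: "('c, 'v) action_desc \<Rightarrow> nat \<Rightarrow>
    (('c, 'v) assign, ('c, 'v) assign) history \<Rightarrow> real option" where
  "total_reward D m h = expected_utility (Tr D m) (history_fm m h)"

text \<open>Transition probabilities and rewards may be undefined; a sum or product (formed with
  \<^const>\<open>those\<close>) is undefined iff one of its terms is.\<close>
record ('s, 'a) mdp =
  mdp_states :: "'s set"
  mdp_actions :: "'a set"
  mdp_T :: "'s \<Rightarrow> 'a \<Rightarrow> 's \<Rightarrow> real option"
  mdp_R :: "'s \<Rightarrow> 'a \<Rightarrow> 's \<Rightarrow> real option"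

definition mdp_reward :: "('s, 'a) mdp \<Rightarrow> nat \<Rightarrow> ('s, 'a) history \<Rightarrow> real option" where
  "mdp_reward M m = (\<lambda>(s, a).
     map_option sum_list (those (map (\<lambda>i. mdp_R M (s i) (a i) (s (i + 1))) [0..<m])))"

definition mdp_prob :: "('s, 'a) mdp \<Rightarrow> nat \<Rightarrow> ('s, 'a) history \<Rightarrow> real option" where
  "mdp_prob M m = (\<lambda>(s, a).
     map_option prod_list (those (map (\<lambda>i. mdp_T M (s i) (a i) (s (i + 1))) [0..<m])))"

definition MDP :: "('c, 'v) action_desc \<Rightarrow> (('c, 'v) assign, ('c, 'v) assign) mdp" where
  "MDP D = \<lparr>
     mdp_states = states D,
     mdp_actions = actions D,
     mdp_T = (\<lambda>s a s'. cond_prob (D_m D 1) (at_time 1 s') (And (at_time 0 s) (at_time 0 a))),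
     mdp_R = (\<lambda>s a s'. expected_utility (D_m D 1)
                 (And (And (at_time 0 s) (at_time 0 a)) (at_time 1 s')))\<rparr>"

section \<open>Consistency with the initial program\<close>

lemma sat_reduct_self [simp]: "sat I (reduct I F) \<longleftrightarrow> sat I F"
  by (induction F) auto

lemma D_init_hard:
  assumes "(Hard, R) \<in> D_init D" obtains G where "R = Imp G Bot"
  using assms unfolding D_init_def mvpp_def by blast

lemma D_init_soft:
  assumes "(Soft w, R) \<in> D_init D" obtains c v where "R = Atom (Eq (0, c) v)" "c \<in> initpf D"
  using assms unfolding D_init_def mvpp_def by auto

text \<open>A stable model of \<open>D_init D\<close> contains only atoms of initpf constants, so there are no fluents.\<close>
lemma SM_D_init_no_fl:
  assumes D: "action_description D" and I: "I \<in> SM (D_init D)"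
  shows "fl D = {}"
proof (rule ccontr)
  assume "fl D \<noteq> {}"
  then obtain c where c: "c \<in> fl D" by blast
  define J where "J = I - {Eq (0, c) v | v. True}"
  have cn: "c \<notin> initpf D" using D c unfolding action_description_def by blast
  have "sat J (reduct I R)" if "R \<in> snd ` sat_part (D_init D) I" for R
  proof -
    from that obtain w where wR: "(w, R) \<in> D_init D" "sat I R" unfolding sat_part_def by auto
    show ?thesis
    proof (cases w)
      case (Soft x)
      with wR(1) obtain d v where "R = Atom (Eq (0, d) v)" "d \<in> initpf D"
        using D_init_soft by blast
      then show ?thesis using wR(2) cn unfolding J_def by auto
    next
      case Hard
      with wR(1) obtain G where "R = Imp G Bot" using D_init_hard by blast
      moreover from this wR(2) have "\<not> sat I G" by simp
      then have "reduct I G = Bot" by (cases G) auto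
      ultimately show ?thesis using wR(2) by simp
    qed
  qed
  moreover have "J \<subseteq> I" unfolding J_def by blast
  ultimately have "J = I" using I unfolding SM_def stable_model_def by blast
  then have no: "Eq (0, c) v \<notin> I" for v unfolding J_def by blast
  have "(Hard, rule Bot (Neg (Disj ((\<lambda>v. Atom (Eq (0, c) v)) ` vals D c)))) \<in> D_init D"
    using c unfolding D_init_def mvpp_def by force
  then have "sat I (Disj ((\<lambda>v. Atom (Eq (0, c) v)) ` vals D c))"
    using I unfolding SM_def by auto
  moreover have "finite (vals D c)" using D c unfolding action_description_def by blast
  ultimately show False using no by (auto simp: sat_Disj)
qed

lemma sat_no_atoms: "set_fm F = {} \<Longrightarrow> sat I F = sat J F"
  by (induction F) auto

lemma sat_reduct_no_atoms: "set_fm F = {} \<Longrightarrow> sat J (reduct I F) = sat I F"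
proof (induction F)
  case (Imp F G) then show ?case using sat_no_atoms[of _ I J] by auto
qed auto

lemma consistent_initI:
  assumes D: "action_description D" and s: "s \<in> states D"
    and I: "I \<in> SM (D_init D)" "sat I (at_time 0 s)"
  shows "consistent_init D s"
proof -
  have nofl: "fl D = {}" using SM_D_init_no_fl[OF D I(1)] .
  then have noreg: "regular D = {}" unfolding fl_def by blast
  obtain K where K: "K \<in> SM (D_m D 0)" using s unfolding states_def residual_stable_model_def by blast
  have noatm: "w = Hard \<and> set_fm R = {}" if "(w, R) \<in> D_m D 0" for w R
  proof -
    have "w = Hard \<and> (\<exists>F G. R = rule (stamp_fm 0 F) (stamp_fm 0 G) \<and> (F, G) \<in> static_laws D)"
      using that nofl noreg unfolding D_m_def mvpp_def by auto
    then obtain F G where FG: "w = Hard" "R = rule (stamp_fm 0 F) (stamp_fm 0 G)"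
        "(F, G) \<in> static_laws D" by blast
    then have "set_fm F = {}" "set_fm G = {}"
      using D nofl unfolding action_description_def fm_over_def atoms_over_def by auto
    then show ?thesis using FG by (simp add: stamp_fm_def fm.set_map)
  qed
  have satm: "sat I R" if "(w, R) \<in> D_m D 0" for w R
    using noatm[OF that] that K sat_no_atoms[of R I K] unfolding SM_def by blast
  let ?P = "D_init D \<union> D_m D 0"
  have "I \<in> SM ?P"
  proof -
    have "\<forall>F\<in>snd ` sat_part ?P I. sat I (reduct I F)"
      unfolding sat_part_def by auto
    moreover have "\<not> (\<forall>F\<in>snd ` sat_part ?P I. sat J (reduct I F))" if "J \<subset> I" for J
    proof -
      have "\<not> (\<forall>F\<in>snd ` sat_part (D_init D) I. sat J (reduct I F))"
        using I(1) that unfolding SM_def stable_model_def by blast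
      moreover have "sat_part (D_init D) I \<subseteq> sat_part ?P I" unfolding sat_part_def by blast
      ultimately show ?thesis by blast
    qed
    ultimately have "stable_model (snd ` sat_part ?P I) I" unfolding stable_model_def by blast
    moreover have "sat I R" if "(Hard, R) \<in> ?P" for R
      using that satm I(1) unfolding SM_def by blast
    ultimately show ?thesis unfolding SM_def by blast
  qed
  then show ?thesis using I(2) unfolding consistent_init_def by blast
qed

end

theory Submission
  imports Defs
begin

text \<open>Splitting a stable model of the program for \<open>m + 1\<close> steps at the constants of the program for
  \<open>m\<close> steps shows that it consists of a stable model \<open>I\<close> of the latter, an action assignment \<open>e\<close>, a
  pf assignment \<open>f\<close>, a state \<open>s'\<close> that is stable for the laws activated by the last slice of \<open>I\<close>
  together with \<open>e\<close> and \<open>f\<close>, and the utility atoms that these determine.  Its weight is the weight of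
  \<open>I\<close> times the product of the probabilities declared for \<open>f\<close>.  Hence the total weight of the stable
  models along a history is the weight of its initial state times a product of step weights, whereas
  following a policy multiplies the total weight by the same constant in every step, because \<open>f\<close> then
  determines \<open>s'\<close>.  In the conditional probability the initial weight cancels, and each
  remaining factor is a transition probability, by the same computation for one step without
  \<open>D_init\<close>.  Utilities are constant on the stable models along a history and add up over its steps.\<close>

section \<open>Reducts and stable models\<close>

text \<open>The standing assumption on successors and the decision process speak of one-step
  programs without \<open>D_init\<close>, where the state at time 0 is chosen freely, whereas a
  history needs the same step at time \<open>i\<close> inside \<open>Tr D m\<close>. The bridge is
  the relation \<open>step\<close>: stamps are stripped and each dynamic law is evaluated on the
  earlier slice, so that a program for the next slice alone remains, which depends neither on the
  time nor on \<open>D_init\<close>. The split works because rules point forward in time: rules of a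
  new layer have their heads in that layer, and a rule whose head is untouched survives in the
  reduct whatever happens to its body. Minimality is carried over in both directions by adding layer
  atoms to a competing reduct model or deleting atoms from it. Definedness needs care as well. A
  reward is undefined exactly if the weight of its step is 0; since the initial weight is positive,
  the total weight along a history vanishes exactly if one of its steps has weight 0, so both sides
  of the reward equation are undefined together. The condition on the initial state and the policy
  always has positive weight.\<close>

lemma sat_cong: "(\<And>a. a \<in> set_fm F \<Longrightarrow> a \<in> I \<longleftrightarrow> a \<in> J) \<Longrightarrow> sat I F = sat J F"
  by (induction F) auto

lemma reduct_cong: "(\<And>a. a \<in> set_fm F \<Longrightarrow> a \<in> I \<longleftrightarrow> a \<in> J) \<Longrightarrow> reduct I F = reduct J F"
proof (induction F)
  case (And F G) then show ?case using sat_cong[of F I J] sat_cong[of G I J] by auto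
next
  case (Or F G) then show ?case using sat_cong[of F I J] sat_cong[of G I J] by auto
next
  case (Imp F G) then show ?case using sat_cong[of F I J] sat_cong[of G I J] by auto
qed auto

lemma set_fm_reduct: "set_fm (reduct I F) \<subseteq> set_fm F"
  by (induction F) auto

text \<open>On \<open>I\<close> itself the reduct is equivalent to \<open>F\<close>, and reducing
  introduces no new atoms. This settles every rule whose atoms a modification of an interpretation
  leaves alone.\<close>

lemma sat_reduct_agree:
  assumes "\<And>a. a \<in> set_fm F \<Longrightarrow> a \<in> I \<longleftrightarrow> a \<in> J"
  shows "sat J (reduct I F) = sat I F"
  using sat_cong[of "reduct I F" I J] assms set_fm_reduct[of I F] by auto

lemma reduct_unsat: "\<not> sat I F \<Longrightarrow> reduct I F = Bot"
  by (cases F) auto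

lemma sat_reduct_Imp:
  "sat I (Imp G F) \<Longrightarrow>
    sat J (reduct I (Imp G F)) \<longleftrightarrow> (sat J (reduct I G) \<longrightarrow> sat J (reduct I F))"
  by simp

lemma sat_reduct_And:
  "sat J (reduct I (And F G)) \<longleftrightarrow> sat J (reduct I F) \<and> sat J (reduct I G)"
  by (auto simp: reduct_unsat)

text \<open>A body false in \<open>I\<close> is reduced to falsity, and otherwise the reduced head
  is true in \<open>J\<close>. Hence it does not matter how \<open>J\<close> treats body atoms;
  constraints with head \<open>Bot\<close> are the extreme case.\<close>

lemma sat_reduct_head:
  assumes "sat I (Imp G F)" "\<And>a. a \<in> set_fm F \<Longrightarrow> a \<in> I \<longleftrightarrow> a \<in> J"
  shows "sat J (reduct I (Imp G F))"
proof (cases "sat I G")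
  case True
  then show ?thesis using assms sat_reduct_agree[of F I J] by simp
next
  case False
  then show ?thesis by (simp add: reduct_unsat)
qed

text \<open>The reduct evaluates the double negation entirely in \<open>I\<close>. A choice rule
  thus protects its atom from deletion if it is in \<open>I\<close>, and imposes nothing
  else.\<close>

lemma sat_reduct_choice: "sat J (reduct I (choice A)) \<longleftrightarrow> (A \<in> I \<longrightarrow> A \<in> J)"
  by auto

lemma set_fm_disjs: "set_fm (disjs Fs) = \<Union> (set_fm ` set Fs)"
  by (induction Fs) (auto simp: disjs_def)

lemma set_fm_Disj: "finite A \<Longrightarrow> set_fm (Disj A) = \<Union> (set_fm ` A)"
  by (simp add: Disj_def enum_of set_fm_disjs)

lemma stable_model_iff:
  "stable_model \<Pi> I \<longleftrightarrow> (\<forall>F\<in>\<Pi>. sat I F) \<and>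
     (\<forall>J\<subseteq>I. (\<forall>F\<in>\<Pi>. sat J (reduct I F)) \<longrightarrow> J = I)"
  unfolding stable_model_def psubset_eq by auto

text \<open>The guard \<open>sat I R\<close> replaces the image of \<open>sat_part\<close>: a rule
  that \<open>I\<close> falsifies imposes nothing, whereas its reduct would be
  \<open>Bot\<close>.\<close>

definition reduct_model :: "'a lpmln \<Rightarrow> 'a set \<Rightarrow> 'a set \<Rightarrow> bool" where
  "reduct_model \<Pi> I J \<longleftrightarrow> (\<forall>w R. (w, R) \<in> \<Pi> \<longrightarrow> sat I R \<longrightarrow> sat J (reduct I R))"

lemma SM_iff:
  "I \<in> SM \<Pi> \<longleftrightarrow> (\<forall>R. (Hard, R) \<in> \<Pi> \<longrightarrow> sat I R) \<and> (\<forall>J\<subseteq>I. reduct_model \<Pi> I J \<longrightarrow> J = I)"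
proof -
  have "(\<forall>F\<in>snd ` sat_part \<Pi> I. sat J (reduct I F)) \<longleftrightarrow> reduct_model \<Pi> I J" for J
    unfolding reduct_model_def sat_part_def by force
  moreover have "\<forall>F\<in>snd ` sat_part \<Pi> I. sat I F" unfolding sat_part_def by auto
  ultimately show ?thesis unfolding SM_def stable_model_iff by auto
qed

text \<open>Atoms outside all rules can be deleted without any reduct noticing, so minimality
  excludes them.\<close>

lemma SM_subset:
  assumes "I \<in> SM \<Pi>" "\<And>w R. (w, R) \<in> \<Pi> \<Longrightarrow> set_fm R \<subseteq> A"
  shows "I \<subseteq> A"
proof -
  have "sat (I \<inter> A) (reduct I R)" if "(w, R) \<in> \<Pi>" "sat I R" for w R
    using sat_reduct_agree[of R I "I \<inter> A"] assms(2) that by blast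
  then have "reduct_model \<Pi> I (I \<inter> A)" unfolding reduct_model_def by blast
  then have "I \<inter> A = I" using assms(1) unfolding SM_iff by blast
  then show ?thesis by blast
qed

lemma finite_set_fm: "finite (set_fm F)"
  by (induction F) auto

lemma finite_SM:
  assumes "finite \<Pi>" shows "finite (SM \<Pi>)"
proof (rule finite_subset)
  show "SM \<Pi> \<subseteq> Pow (\<Union>(w, R)\<in>\<Pi>. set_fm R)" 
    by (intro subsetI PowI SM_subset) auto
  show "finite (Pow (\<Union>(w, R)\<in>\<Pi>. set_fm R))" using assms finite_set_fm by auto
qed

section \<open>Multi-valued programs\<close>

lemma hard_in_mvpp:
  "(Hard, R) \<in> mvpp C Dom PC p \<Pi> \<longleftrightarrow> R \<in> \<Pi>
     \<or> (\<exists>c v v'. R = rule Bot (And (Atom (Eq c v)) (Atom (Eq c v'))) \<and>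
          c \<in> C \<and> v \<in> Dom c \<and> v' \<in> Dom c \<and> v \<noteq> v')
     \<or> (\<exists>c. R = rule Bot (Neg (Disj ((\<lambda>v. Atom (Eq c v)) ` Dom c))) \<and> c \<in> C)"
  unfolding mvpp_def by simp

lemma soft_in_mvpp:
  "(Soft w, R) \<in> mvpp C Dom PC p \<Pi> \<longleftrightarrow>
     (\<exists>c v. w = ln (p c v) \<and> R = Atom (Eq c v) \<and> c \<in> PC \<and> v \<in> Dom c)"
  unfolding mvpp_def by simp

text \<open>Serves to read \<open>Tr\<close> as a single program. The constraints for a constant in
  both \<open>C\<close> and \<open>C'\<close>, such as a fluent at time 0, are equal and merge in
  the union.\<close>

lemma mvpp_Un:
  "mvpp C Dom PC p \<Pi> \<union> mvpp C' Dom PC' p \<Pi>' = mvpp (C \<union> C') Dom (PC \<union> PC') p (\<Pi> \<union> \<Pi>')"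
proof -
  have "(w, R) \<in> mvpp C Dom PC p \<Pi> \<union> mvpp C' Dom PC' p \<Pi>' \<longleftrightarrow>
      (w, R) \<in> mvpp (C \<union> C') Dom (PC \<union> PC') p (\<Pi> \<union> \<Pi>')" for w R
  proof (cases w)
    case (Soft x)
    show ?thesis unfolding Soft Un_iff soft_in_mvpp by (simp add: conj_disj_distribL conj_disj_distribR ex_disj_distrib)
  next
    case Hard
    show ?thesis unfolding Hard Un_iff hard_in_mvpp
      by (simp only: Un_iff conj_disj_distribL conj_disj_distribR ex_disj_distrib disj_ac)
  qed
  then show ?thesis by auto
qed

lemma mvpp_hard_iff:
  assumes "\<And>c. c \<in> C \<Longrightarrow> finite (Dom c)"
  shows "(\<forall>R. (Hard, R) \<in> mvpp C Dom PC p \<Pi> \<longrightarrow> sat I R) \<longleftrightarrow>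
     (\<forall>R\<in>\<Pi>. sat I R) \<and> (\<forall>c\<in>C. \<exists>!v. v \<in> Dom c \<and> Eq c v \<in> I)"
    (is "?L \<longleftrightarrow> ?R")
proof
  assume L: ?L
  have "\<exists>!v. v \<in> Dom c \<and> Eq c v \<in> I" if c: "c \<in> C" for c
  proof -
    have "sat I (rule Bot (Neg (Disj ((\<lambda>v. Atom (Eq c v)) ` Dom c))))"
      using L c unfolding hard_in_mvpp by blast
    then obtain v where "v \<in> Dom c" "Eq c v \<in> I" using assms[OF c] by (auto simp: sat_Disj)
    moreover have "v' = v''"
      if "v' \<in> Dom c \<and> Eq c v' \<in> I" "v'' \<in> Dom c \<and> Eq c v'' \<in> I" for v' v''
    proof (rule ccontr)
      assume "v' \<noteq> v''"
      then have "sat I (rule Bot (And (Atom (Eq c v')) (Atom (Eq c v''))))"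
        using L c that unfolding hard_in_mvpp by blast
      then show False using that by simp
    qed
    ultimately show ?thesis by blast
  qed
  moreover have "sat I R" if "R \<in> \<Pi>" for R using L that unfolding hard_in_mvpp by blast
  ultimately show ?R by blast
next
  assume R: ?R
  have "sat I (rule Bot (And (Atom (Eq c v)) (Atom (Eq c v'))))"
    if "c \<in> C" "v \<in> Dom c" "v' \<in> Dom c" "v \<noteq> v'" for c v v'
    using R that by auto
  moreover have "sat I (rule Bot (Neg (Disj ((\<lambda>v. Atom (Eq c v)) ` Dom c))))" if "c \<in> C" for c
    using R that assms[OF that] by (auto simp: sat_Disj)
  ultimately show ?L using R unfolding hard_in_mvpp by blast
qed

text \<open>Constraints have head \<open>Bot\<close>, so every \<open>J\<close> satisfies their
  reducts. A soft rule counts only if \<open>I\<close> satisfies it, and then its reduct is the atom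
  itself: \<open>J\<close> cannot drop the probabilistic atoms of \<open>I\<close>.\<close>

lemma mvpp_reduct_iff:
  assumes "\<forall>R. (Hard, R) \<in> mvpp C Dom PC p \<Pi> \<longrightarrow> sat I R"
  shows "reduct_model (mvpp C Dom PC p \<Pi>) I J \<longleftrightarrow>
     (\<forall>c\<in>PC. \<forall>v\<in>Dom c. Eq c v \<in> I \<longrightarrow> Eq c v \<in> J) \<and> (\<forall>R\<in>\<Pi>. sat J (reduct I R))"
    (is "?L \<longleftrightarrow> ?R")
proof
  assume L: ?L
  have "Eq c v \<in> J" if "c \<in> PC" "v \<in> Dom c" "Eq c v \<in> I" for c v
  proof -
    have "(Soft (ln (p c v)), Atom (Eq c v)) \<in> mvpp C Dom PC p \<Pi>"
      using that unfolding mvpp_def by blast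
    then have "sat J (reduct I (Atom (Eq c v)))"
      using L that(3) unfolding reduct_model_def by (metis sat.simps(2))
    then show ?thesis using that(3) by simp
  qed
  moreover have "sat J (reduct I R)" if "R \<in> \<Pi>" for R
  proof -
    have "(Hard, R) \<in> mvpp C Dom PC p \<Pi>" using that unfolding mvpp_def by blast
    then show ?thesis using L assms unfolding reduct_model_def by blast
  qed
  ultimately show ?R by blast
next
  assume R: ?R
  have "sat J (reduct I X)" if X: "(w, X) \<in> mvpp C Dom PC p \<Pi>" "sat I X" for w X
  proof -
    from X(1) consider c v where "c \<in> PC" "v \<in> Dom c" "X = Atom (Eq c v)" | "X \<in> \<Pi>"
      | G where "X = Imp G Bot"
      unfolding mvpp_def by blast
    then show ?thesis
    proof cases
      case 3
      then show ?thesis using sat_reduct_head[of I G Bot J] X(2) by simp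
    qed (use R X(2) in auto)
  qed
  then show ?L unfolding reduct_model_def by blast
qed

text \<open>The working form of stability: constraints restrict only \<open>I\<close>, soft rules
  only the competitor \<open>J\<close>, and weights have disappeared.\<close>

lemma SM_mvpp_iff:
  assumes "\<And>c. c \<in> C \<Longrightarrow> finite (Dom c)"
  shows "I \<in> SM (mvpp C Dom PC p \<Pi>) \<longleftrightarrow>
     (\<forall>R\<in>\<Pi>. sat I R) \<and> (\<forall>c\<in>C. \<exists>!v. v \<in> Dom c \<and> Eq c v \<in> I) \<and>
     (\<forall>J\<subseteq>I. (\<forall>c\<in>PC. \<forall>v\<in>Dom c. Eq c v \<in> I \<longrightarrow> Eq c v \<in> J) \<and> (\<forall>R\<in>\<Pi>. sat J (reduct I R))
        \<longrightarrow> J = I)"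
proof (cases "\<forall>R. (Hard, R) \<in> mvpp C Dom PC p \<Pi> \<longrightarrow> sat I R")
  case True
  then show ?thesis
    unfolding SM_iff using mvpp_hard_iff[of C Dom PC p \<Pi> I, OF assms] mvpp_reduct_iff[OF True]
    by simp
next
  case False
  have "\<not> ((\<forall>R\<in>\<Pi>. sat I R) \<and> (\<forall>c\<in>C. \<exists>!v. v \<in> Dom c \<and> Eq c v \<in> I))"
    using False by (subst mvpp_hard_iff[of C Dom PC p \<Pi> I, OF assms, symmetric])
  then show ?thesis unfolding SM_iff using False by blast
qed

lemma mvpp_atoms:
  assumes "\<And>c. c \<in> C \<Longrightarrow> finite (Dom c)" "PC \<subseteq> C" "(w, R) \<in> mvpp C Dom PC p \<Pi>"
  shows "set_fm R \<subseteq> {Eq c v | c v. c \<in> C \<and> v \<in> Dom c} \<union> \<Union> (set_fm ` \<Pi>)"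
proof -
  from assms(3) consider c v where "c \<in> PC" "v \<in> Dom c" "R = Atom (Eq c v)" | "R \<in> \<Pi>"
    | c v v' where "c \<in> C" "v \<in> Dom c" "v' \<in> Dom c"
        "R = rule Bot (And (Atom (Eq c v)) (Atom (Eq c v')))"
    | c where "c \<in> C" "R = rule Bot (Neg (Disj ((\<lambda>v. Atom (Eq c v)) ` Dom c)))"
    unfolding mvpp_def by blast
  then show ?thesis
  proof cases
    case 4
    then show ?thesis using assms(1) by (auto simp: set_fm_Disj)
  qed (use assms(2) in auto)
qed

lemma SM_mvpp_subset:
  assumes "\<And>c. c \<in> C \<Longrightarrow> finite (Dom c)" "PC \<subseteq> C" "I \<in> SM (mvpp C Dom PC p \<Pi>)"
  shows "I \<subseteq> {Eq c v | c v. c \<in> C \<and> v \<in> Dom c} \<union> \<Union> (set_fm ` \<Pi>)"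
  by (rule SM_subset[OF assms(3)]) (rule mvpp_atoms[OF assms(1,2)])

lemma finite_mvpp:
  assumes "finite C" "\<And>c. c \<in> C \<Longrightarrow> finite (Dom c)" "PC \<subseteq> C" "finite \<Pi>"
  shows "finite (mvpp C Dom PC p \<Pi>)"
proof -
  let ?S = "(\<Union>c\<in>PC. \<Union>v\<in>Dom c. {(Soft (ln (p c v)), Atom (Eq c v))})
    \<union> (\<Union>R\<in>\<Pi>. {(Hard, R)})
    \<union> (\<Union>c\<in>C. \<Union>v\<in>Dom c. \<Union>v'\<in>Dom c. {(Hard, rule Bot (And (Atom (Eq c v)) (Atom (Eq c v'))))})
    \<union> (\<Union>c\<in>C. {(Hard, rule Bot (Neg (Disj ((\<lambda>v. Atom (Eq c v)) ` Dom c))))})"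
  have "finite PC" using assms finite_subset by blast
  then have "finite ?S" using assms by (simp add: subset_iff)
  moreover have "mvpp C Dom PC p \<Pi> \<subseteq> ?S"
  proof
    fix x assume x: "x \<in> mvpp C Dom PC p \<Pi>"
    obtain w R where wR: "x = (w, R)" by (cases x)
    show "x \<in> ?S"
      using x unfolding wR by (cases w) (auto simp: soft_in_mvpp hard_in_mvpp)
  qed
  ultimately show ?thesis by (rule finite_subset[rotated])
qed

section \<open>Time slices\<close>

definition proj :: "('c, 'v) tatm set \<Rightarrow> nat \<Rightarrow> ('c, 'v) assign" where
  "proj I i = {(c, v). Eq (i, c) v \<in> I}"

text \<open>An unstamped slice can be compared across time points and across programs; cutting it
  down to declared values of the constants in \<open>C\<close> makes it an element of
  \<open>assigns D C\<close> for stable models.\<close>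

definition part :: "('c, 'v) action_desc \<Rightarrow> 'c set \<Rightarrow> ('c, 'v) tatm set \<Rightarrow> nat \<Rightarrow> ('c, 'v) assign" where
  "part D C I i = proj I i \<inter> atoms_over D C"

lemma in_part: "(c, v) \<in> part D C I i \<longleftrightarrow> Eq (i, c) v \<in> I \<and> c \<in> C \<and> v \<in> vals D c"
  unfolding part_def proj_def atoms_over_def by auto

lemma in_stamp: "Eq (j, c) v \<in> stamp i s \<longleftrightarrow> j = i \<and> (c, v) \<in> s"
  unfolding stamp_def by force

lemma utility_notin_stamp [simp]: "Utility u t \<notin> stamp i s"
  unfolding stamp_def by auto

lemma set_fm_stamp: "set_fm (stamp_fm i F) = stamp i (set_fm F)"
  unfolding stamp_fm_def stamp_def by (simp add: fm.set_map)

lemma sat_stamp: "sat I (stamp_fm i F) = sat (proj I i) F"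
  unfolding stamp_fm_def by (induction F) (auto simp: proj_def)

lemma reduct_stamp: "reduct I (stamp_fm i F) = stamp_fm i (reduct (proj I i) F)"
proof (induction F)
  case (Atom a) then show ?case by (auto simp: stamp_fm_def proj_def)
qed (use sat_stamp[of I i] in \<open>auto simp: stamp_fm_def\<close>)

lemma sat_over: "fm_over D C F \<Longrightarrow> sat (X \<inter> atoms_over D C) F = sat X F"
  unfolding fm_over_def by (intro sat_cong) auto

lemma sat_stamp_part: "fm_over D C F \<Longrightarrow> sat I (stamp_fm i F) = sat (part D C I i) F"
  unfolding part_def by (simp add: sat_stamp sat_over)

text \<open>Stamping only renames atoms, and \<open>F\<close> sees only atoms over \<open>C\<close>;
  so reducing commutes with passing to slices.\<close>

lemma sat_reduct_stamp:
  assumes "fm_over D C F"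
  shows "sat J (reduct I (stamp_fm i F)) = sat (part D C J i) (reduct (part D C I i) F)"
proof -
  have "reduct (proj I i) F = reduct (part D C I i) F"
    using assms unfolding fm_over_def part_def by (intro reduct_cong) auto
  moreover have "fm_over D C (reduct (part D C I i) F)"
    using assms set_fm_reduct[of _ F] unfolding fm_over_def by blast
  ultimately show ?thesis by (simp add: reduct_stamp sat_stamp_part)
qed

lemma atoms_over_Un: "atoms_over D (A \<union> B) = atoms_over D A \<union> atoms_over D B"
  unfolding atoms_over_def by auto

lemma part_Un: "part D (A \<union> B) I i = part D A I i \<union> part D B I i"
  unfolding part_def atoms_over_Un by blast

lemma fm_over_mono: "fm_over D A F \<Longrightarrow> A \<subseteq> B \<Longrightarrow> fm_over D B F"
  unfolding fm_over_def atoms_over_def by blast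

section \<open>\<open>D_m\<close> and \<open>Tr\<close> as programs that grow layer by layer\<close>

locale action_theory =
  fixes D :: "('c, 'v) action_desc"
  assumes desc: "action_description D"
begin

lemma disjoint_sorts:
  "fl D \<inter> act D = {}" "fl D \<inter> pf D = {}" "fl D \<inter> initpf D = {}"
  "act D \<inter> pf D = {}" "act D \<inter> initpf D = {}" "pf D \<inter> initpf D = {}"
  using desc unfolding action_description_def by auto

lemma finite_vals: "c \<in> fl D \<union> act D \<union> pf D \<union> initpf D \<Longrightarrow> finite (vals D c)"
  using desc unfolding action_description_def by blast

lemma finite_sorts: "finite (fl D)" "finite (act D)" "finite (pf D)" "finite (initpf D)"
  using desc unfolding action_description_def fl_def by auto

lemma vals_act: "c \<in> act D \<Longrightarrow> vals D c = {BVal True, BVal False}"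
  using desc unfolding action_description_def by blast

lemma static_over:
  assumes "(F, G) \<in> static_laws D" shows "fm_over D (fl D) F" "fm_over D (fl D) G"
  using desc assms unfolding action_description_def by blast+

lemma dynamic_over:
  assumes "(F, G, H) \<in> dynamic_laws D"
  shows "fm_over D (regular D) F" "fm_over D (fl D) F" "fm_over D (fl D) G"
    "fm_over D (fl D \<union> act D \<union> pf D) H"
proof -
  show "fm_over D (regular D) F" "fm_over D (fl D) G" "fm_over D (fl D \<union> act D \<union> pf D) H"
    using desc assms unfolding action_description_def by blast+
  then show "fm_over D (fl D) F" using fm_over_mono[of D "regular D" F "fl D"] unfolding fl_def by blast
qed

lemma utility_over:
  assumes "(v, F, G) \<in> utility_laws D" shows "fm_over D (fl D) F" "fm_over D (fl D \<union> act D) G"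
  using desc assms unfolding action_description_def by blast+

lemma uid_inj:
  "\<lbrakk>(v, F, G) \<in> utility_laws D; (v', F', G') \<in> utility_laws D; uid D (v, F, G) = uid D (v', F', G')\<rbrakk>
    \<Longrightarrow> v = v' \<and> F = F' \<and> G = G'"
  using desc unfolding action_description_def inj_on_def by blast

lemma initial_over:
  assumes "(A, G) \<in> initial_laws D" shows "A \<in> atoms_over D (fl D)" "fm_over D (fl D \<union> initpf D) G"
  using desc assms unfolding action_description_def by blast+

definition static_rules :: "nat \<Rightarrow> ('c, 'v) tatm fm set" where
  "static_rules i = {rule (stamp_fm i F) (stamp_fm i G) | F G. (F, G) \<in> static_laws D}"

definition dynamic_rules :: "nat \<Rightarrow> ('c, 'v) tatm fm set" where
  "dynamic_rules i = {rule (stamp_fm (Suc i) F) (And (stamp_fm (Suc i) G) (stamp_fm i H)) | F G H.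
     (F, G, H) \<in> dynamic_laws D}"

definition action_rules :: "nat \<Rightarrow> ('c, 'v) tatm fm set" where
  "action_rules i = {choice (Eq (i, c) (BVal x)) | c x. c \<in> act D}"

definition utility_rules :: "nat \<Rightarrow> ('c, 'v) tatm fm set" where
  "utility_rules i = {rule (Atom (Utility v [Suc i, uid D (v, F, G)]))
     (And (stamp_fm (Suc i) F) (stamp_fm i G)) | v F G. (v, F, G) \<in> utility_laws D}"

definition initial_choices :: "('c, 'v) tatm fm set" where
  "initial_choices = {choice (Eq (0, c) v) | c v. c \<in> regular D \<and> v \<in> vals D c}"

definition initial_constraints :: "('c, 'v) tatm fm set" where
  "initial_constraints =
     {rule Bot (And (Neg (Atom (stamp_atom 0 A))) (stamp_fm 0 G)) | A G. (A, G) \<in> initial_laws D}"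

definition layer_rules :: "nat \<Rightarrow> ('c, 'v) tatm fm set" where
  "layer_rules i = static_rules (Suc i) \<union> dynamic_rules i \<union> action_rules i \<union> utility_rules i"

text \<open>What one more step adds: fluents stamped after the step, actions and pf constants
  stamped before it.\<close>

definition layer_consts :: "nat \<Rightarrow> (nat \<times> 'c) set" where
  "layer_consts i = {Suc i} \<times> fl D \<union> {i} \<times> (act D \<union> pf D)"

text \<open>The parameter \<open>b\<close> tells whether \<open>D_init D\<close> is included, so that \<open>D_m D m\<close> and \<open>Tr D m\<close>
  are treated together.\<close>
primrec rules :: "bool \<Rightarrow> nat \<Rightarrow> ('c, 'v) tatm fm set" where
  "rules b 0 = static_rules 0 \<union> initial_choices \<union> (if b then initial_constraints else {})"
| "rules b (Suc m) = rules b m \<union> layer_rules m"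

primrec consts_of :: "bool \<Rightarrow> nat \<Rightarrow> (nat \<times> 'c) set" where
  "consts_of b 0 = {0} \<times> (fl D \<union> (if b then initpf D else {}))"
| "consts_of b (Suc m) = consts_of b m \<union> layer_consts m"

primrec pconsts_of :: "bool \<Rightarrow> nat \<Rightarrow> (nat \<times> 'c) set" where
  "pconsts_of b 0 = {0} \<times> (if b then initpf D else {})"
| "pconsts_of b (Suc m) = pconsts_of b m \<union> {m} \<times> pf D"

definition prog :: "bool \<Rightarrow> nat \<Rightarrow> ('c, 'v) tatm lpmln" where
  "prog b m = mvpp (consts_of b m) (\<lambda>k. vals D (snd k)) (pconsts_of b m)
     (\<lambda>k. decl D (snd k)) (rules b m)"

lemma consts_of_False: "consts_of False m = {..m} \<times> fl D \<union> {..<m} \<times> (act D \<union> pf D)"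
  by (induction m) (auto simp: layer_consts_def atMost_Suc lessThan_Suc)

lemma consts_of_True: "consts_of True m = consts_of False m \<union> {0} \<times> (initpf D \<union> fl D)"
  by (induction m) auto

lemma pconsts_of_False: "pconsts_of False m = {..<m} \<times> pf D"
  by (induction m) (auto simp: lessThan_Suc)

lemma pconsts_of_True: "pconsts_of True m = pconsts_of False m \<union> {0} \<times> initpf D"
  by (induction m) auto

lemma rules_False:
  "rules False m = (\<Union>i\<le>m. static_rules i) \<union> (\<Union>i<m. dynamic_rules i) \<union> initial_choices
     \<union> (\<Union>i<m. action_rules i) \<union> (\<Union>i<m. utility_rules i)"
  by (induction m) (auto simp: layer_rules_def lessThan_Suc atMost_Suc)

lemma rules_True: "rules True m = rules False m \<union> initial_constraints"
  by (induction m) auto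

lemma D_m_eq: "D_m D m = prog False m"
proof -
  have "(\<Union>i\<le>m. static_rules i) =
      {rule (stamp_fm i F) (stamp_fm i G) | i F G. i \<le> m \<and> (F, G) \<in> static_laws D}"
    unfolding static_rules_def by blast
  moreover have "(\<Union>i<m. dynamic_rules i) =
      {rule (stamp_fm (i + 1) F) (And (stamp_fm (i + 1) G) (stamp_fm i H)) | i F G H.
         i < m \<and> (F, G, H) \<in> dynamic_laws D}"
    unfolding dynamic_rules_def Suc_eq_plus1 by blast
  moreover have "(\<Union>i<m. action_rules i) = {choice (Eq (i, c) (BVal b)) | i c b. i < m \<and> c \<in> act D}"
    unfolding action_rules_def by blast
  moreover have "(\<Union>i<m. utility_rules i) =
      {rule (Atom (Utility v [i + 1, uid D (v, F, G)]))
         (And (stamp_fm (i + 1) F) (stamp_fm i G)) | i v F G. i < m \<and> (v, F, G) \<in> utility_laws D}"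
    unfolding utility_rules_def Suc_eq_plus1 by blast
  ultimately show ?thesis
    unfolding D_m_def prog_def rules_False consts_of_False pconsts_of_False initial_choices_def
      case_prod_unfold by simp
qed

lemma D_init_eq: "D_init D = mvpp ({0} \<times> (initpf D \<union> fl D)) (\<lambda>k. vals D (snd k))
    ({0} \<times> initpf D) (\<lambda>k. decl D (snd k)) initial_constraints"
  unfolding D_init_def initial_constraints_def case_prod_unfold by simp

lemma Tr_eq: "Tr D m = prog True m"
  unfolding Tr_def D_m_eq D_init_eq
  unfolding prog_def mvpp_Un consts_of_True pconsts_of_True rules_True ..

lemma init_eq: "D_init D \<union> D_m D 0 = prog True 0"
  using Tr_eq[of 0] unfolding Tr_def by (simp add: Un_commute)

definition eqs :: "(nat \<times> 'c) set \<Rightarrow> ('c, 'v) tatm set" where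
  "eqs K = {Eq k v | k v. k \<in> K \<and> v \<in> vals D (snd k)}"

definition uatoms :: "nat \<Rightarrow> ('c, 'v) tatm set" where
  "uatoms i = {Utility v [Suc i, uid D (v, F, G)] | v F G. (v, F, G) \<in> utility_laws D}"

definition layer :: "nat \<Rightarrow> ('c, 'v) tatm set" where
  "layer i = eqs (layer_consts i) \<union> uatoms i"

definition sig :: "bool \<Rightarrow> nat \<Rightarrow> ('c, 'v) tatm set" where
  "sig b m = eqs (consts_of b m) \<union> (\<Union>i<m. uatoms i)"

lemma sig_Suc: "sig b (Suc m) = sig b m \<union> layer m"
  unfolding sig_def layer_def eqs_def lessThan_Suc by auto

lemma in_eqs: "Eq k v \<in> eqs K \<longleftrightarrow> k \<in> K \<and> v \<in> vals D (snd k)" "Utility u t \<notin> eqs K"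
  unfolding eqs_def by (auto simp del: split_paired_Ex)

lemma consts_of_iff:
  "(i, c) \<in> consts_of b m \<longleftrightarrow>
     i \<le> m \<and> c \<in> fl D \<or> i < m \<and> c \<in> act D \<union> pf D \<or> b \<and> i = 0 \<and> c \<in> initpf D"
  by (cases b) (auto simp: consts_of_False consts_of_True)

lemma layer_consts_iff:
  "(i, c) \<in> layer_consts m \<longleftrightarrow> i = Suc m \<and> c \<in> fl D \<or> i = m \<and> c \<in> act D \<union> pf D"
  unfolding layer_consts_def by auto

lemma eq_in_sig: "Eq (i, c) v \<in> sig b m \<longleftrightarrow> (i, c) \<in> consts_of b m \<and> v \<in> vals D c"
  unfolding sig_def uatoms_def by (auto simp: in_eqs)

lemma eq_in_layer: "Eq (i, c) v \<in> layer m \<longleftrightarrow> (i, c) \<in> layer_consts m \<and> v \<in> vals D c"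
  unfolding layer_def uatoms_def by (auto simp: in_eqs)

text \<open>Both sides may contain constants with stamp \<open>m\<close>: fluents (and, for
  \<open>m = 0\<close>, initpf constants) on the left, actions and pf constants on the right.
  Disjointness of the sorts separates these; the stamp in the argument list separates utility
  atoms.\<close>

lemma sig_layer_disjoint: "sig b m \<inter> layer m = {}"
proof -
  have "a \<notin> layer m" if "a \<in> sig b m" for a
  proof (cases a)
    case (Eq k v)
    obtain i c where k: "k = (i, c)" by (cases k)
    show ?thesis using that disjoint_sorts
      unfolding Eq k eq_in_sig eq_in_layer consts_of_iff layer_consts_iff by auto
  next
    case (Utility u t)
    then show ?thesis using that unfolding sig_def layer_def uatoms_def by (auto simp: in_eqs)
  qed
  then show ?thesis by blast
qed

lemma stamp_subset_eqs: "X \<subseteq> atoms_over D C \<Longrightarrow> {i} \<times> C \<subseteq> K \<Longrightarrow> stamp i X \<subseteq> eqs K"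
  unfolding stamp_def atoms_over_def by (auto simp: in_eqs subset_iff)

lemma set_fm_stamp_subset: "fm_over D C F \<Longrightarrow> {i} \<times> C \<subseteq> K \<Longrightarrow> set_fm (stamp_fm i F) \<subseteq> eqs K"
  unfolding set_fm_stamp fm_over_def by (rule stamp_subset_eqs)

lemma static_rules_atoms:
  assumes "R \<in> static_rules i" "{i} \<times> fl D \<subseteq> K" shows "set_fm R \<subseteq> eqs K"
proof -
  obtain F G where "R = rule (stamp_fm i F) (stamp_fm i G)" "(F, G) \<in> static_laws D"
    using assms(1) unfolding static_rules_def by blast
  then show ?thesis using set_fm_stamp_subset[of "fl D" _ i K] static_over assms(2) by simp
qed

lemma layer_rules_atoms:
  assumes "R \<in> layer_rules m" shows "set_fm R \<subseteq> sig b (Suc m)"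
proof -
  let ?K = "consts_of b (Suc m)"
  have s: "{Suc m} \<times> fl D \<subseteq> ?K" "{m} \<times> (fl D \<union> act D \<union> pf D) \<subseteq> ?K" "{m} \<times> (fl D \<union> act D) \<subseteq> ?K"
    by (auto simp: consts_of_iff layer_consts_iff)
  have E: "eqs ?K \<subseteq> sig b (Suc m)" unfolding sig_def by blast
  from assms consider "R \<in> static_rules (Suc m)" | "R \<in> dynamic_rules m" | "R \<in> action_rules m"
    | "R \<in> utility_rules m" unfolding layer_rules_def by blast
  then show ?thesis
  proof cases
    case 1
    then show ?thesis using static_rules_atoms[OF 1 s(1)] E by blast
  next
    case 2
    then obtain F G H where "R = rule (stamp_fm (Suc m) F) (And (stamp_fm (Suc m) G) (stamp_fm m H))"
      "(F, G, H) \<in> dynamic_laws D" unfolding dynamic_rules_def by blast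
    then have "set_fm R \<subseteq> eqs ?K"
      using set_fm_stamp_subset[OF dynamic_over(2) s(1)] set_fm_stamp_subset[OF dynamic_over(3) s(1)]
        set_fm_stamp_subset[OF dynamic_over(4) s(2)] by simp
    then show ?thesis using E by blast
  next
    case 3
    then obtain c x where "R = choice (Eq (m, c) (BVal x))" "c \<in> act D"
      unfolding action_rules_def by blast
    then show ?thesis by (auto simp: eq_in_sig consts_of_iff layer_consts_iff vals_act)
  next
    case 4
    then obtain v F G where R: "R = rule (Atom (Utility v [Suc m, uid D (v, F, G)]))
        (And (stamp_fm (Suc m) F) (stamp_fm m G))" "(v, F, G) \<in> utility_laws D"
      unfolding utility_rules_def by blast
    then have "set_fm R \<subseteq> insert (Utility v [Suc m, uid D (v, F, G)]) (eqs ?K)"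
      using set_fm_stamp_subset[OF utility_over(1)[OF R(2)] s(1)]
        set_fm_stamp_subset[OF utility_over(2)[OF R(2)] s(3)]
      by auto
    moreover have "Utility v [Suc m, uid D (v, F, G)] \<in> sig b (Suc m)"
      using R(2) unfolding sig_def uatoms_def by blast
    ultimately show ?thesis using E by blast
  qed
qed

lemma rules_atoms: "R \<in> rules b m \<Longrightarrow> set_fm R \<subseteq> sig b m"
proof (induction m)
  case 0
  then consider "R \<in> static_rules 0" | "R \<in> initial_choices" | "b" "R \<in> initial_constraints"
    by (auto split: if_splits)
  then show ?case
  proof cases
    case 1
    have "{0} \<times> fl D \<subseteq> consts_of b 0" by auto
    then show ?thesis using static_rules_atoms[OF 1] unfolding sig_def by blast
  next
    case 2
    then show ?thesis
      unfolding initial_choices_def by (auto simp: eq_in_sig fl_def)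
  next
    case 3
    then obtain A G where R: "R = rule Bot (And (Neg (Atom (stamp_atom 0 A))) (stamp_fm 0 G))"
      "(A, G) \<in> initial_laws D" unfolding initial_constraints_def by blast
    have "set_fm (stamp_fm 0 G) \<subseteq> eqs (consts_of b 0)"
      using set_fm_stamp_subset[OF initial_over(2)[OF R(2)], of 0 "consts_of b 0"] 3(1) by auto
    moreover have "stamp_atom 0 A \<in> eqs (consts_of b 0)"
      using initial_over(1)[OF R(2)] unfolding atoms_over_def by (auto simp: in_eqs)
    ultimately show ?thesis unfolding R(1) sig_def by auto
  qed
next
  case (Suc m)
  then show ?case using layer_rules_atoms[of R m b] by (auto simp: sig_Suc)
qed

text \<open>The splitting condition. Bodies reach back to time \<open>m\<close>, but for
  \<open>sat_reduct_head\<close> only the heads matter.\<close>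

lemma layer_rules_heads:
  assumes "R \<in> layer_rules m" shows "\<exists>F G. R = Imp G F \<and> set_fm F \<subseteq> layer m"
proof -
  from assms consider "R \<in> static_rules (Suc m)" | "R \<in> dynamic_rules m" | "R \<in> action_rules m"
    | "R \<in> utility_rules m" unfolding layer_rules_def by blast
  moreover have head: "set_fm (stamp_fm (Suc m) F) \<subseteq> layer m" if "fm_over D (fl D) F" for F
    using set_fm_stamp_subset[OF that, of "Suc m" "layer_consts m"]
    unfolding layer_consts_def layer_def by blast
  ultimately show ?thesis
  proof cases
    case 1
    then show ?thesis using head static_over unfolding static_rules_def by blast
  next
    case 2
    then show ?thesis using head dynamic_over unfolding dynamic_rules_def by blast
  next
    case 3
    then show ?thesis
      unfolding action_rules_def by (auto simp: eq_in_layer layer_consts_iff vals_act)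
  next
    case 4
    then show ?thesis unfolding utility_rules_def layer_def uatoms_def by auto
  qed
qed

lemma consts_of_finite_vals: "k \<in> consts_of b m \<Longrightarrow> finite (vals D (snd k))"
  using finite_vals by (cases k) (auto simp: consts_of_iff)

lemma pconsts_of_subset: "pconsts_of b m \<subseteq> consts_of b m"
  by (induction m) (auto simp: layer_consts_def)

lemma SM_prog_iff:
  "I \<in> SM (prog b m) \<longleftrightarrow>
     (\<forall>R\<in>rules b m. sat I R) \<and>
     (\<forall>k\<in>consts_of b m. \<exists>!v. v \<in> vals D (snd k) \<and> Eq k v \<in> I) \<and>
     (\<forall>J\<subseteq>I. (\<forall>k\<in>pconsts_of b m. \<forall>v\<in>vals D (snd k). Eq k v \<in> I \<longrightarrow> Eq k v \<in> J) \<and>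
        (\<forall>R\<in>rules b m. sat J (reduct I R)) \<longrightarrow> J = I)"
  unfolding prog_def by (rule SM_mvpp_iff[OF consts_of_finite_vals])

lemma SM_prog_subset:
  assumes "I \<in> SM (prog b m)" shows "I \<subseteq> sig b m"
proof -
  have "I \<subseteq> {Eq k v |k v. k \<in> consts_of b m \<and> v \<in> vals D (snd k)} \<union> \<Union> (set_fm ` rules b m)"
    by (rule SM_mvpp_subset[OF _ pconsts_of_subset assms[unfolded prog_def]])
      (rule consts_of_finite_vals)
  then show ?thesis using rules_atoms unfolding sig_def eqs_def by blast
qed

section \<open>Splitting off the last layer\<close>

text \<open>The rules of \<open>D_m D 0\<close> without stamps; among the assignments to fluents,
  its stable models are the states.\<close>

definition base_laws :: "('c, 'v) law_fm set" where
  "base_laws = {rule F G | F G. (F, G) \<in> static_laws D}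
     \<union> {choice (c, v) | c v. c \<in> regular D \<and> v \<in> vals D c}"

text \<open>The program for the next slice after partial evaluation: the part \<open>H\<close> of a
  dynamic law concerns only the earlier slice \<open>x\<close> and is decided there.\<close>

definition next_laws :: "('c, 'v) assign \<Rightarrow> ('c, 'v) law_fm set" where
  "next_laws x = {rule F G | F G. (F, G) \<in> static_laws D}
     \<union> {rule F G | F G H. (F, G, H) \<in> dynamic_laws D \<and> sat x H}"

text \<open>A form of pf-transitions that mentions neither time stamps nor utility atoms, so that it
  applies at every time and with or without \<open>D_init\<close>.\<close>

definition step :: "('c, 'v) assign \<Rightarrow> ('c, 'v) assign \<Rightarrow> ('c, 'v) assign \<Rightarrow> ('c, 'v) assign \<Rightarrow> bool" where
  "step s e f s' \<longleftrightarrow> e \<in> assigns D (act D) \<and> f \<in> assigns D (pf D) \<and> s' \<in> assigns D (fl D) \<and>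
     stable_model (next_laws (s \<union> e \<union> f)) s'"

definition rewards :: "nat \<Rightarrow> ('c, 'v) assign \<Rightarrow> ('c, 'v) assign \<Rightarrow> ('c, 'v) assign \<Rightarrow> ('c, 'v) tatm set" where
  "rewards i s e s' = {Utility v [Suc i, uid D (v, F, G)] | v F G.
     (v, F, G) \<in> utility_laws D \<and> sat s' F \<and> sat (s \<union> e) G}"

text \<open>The state before the step is read off \<open>I\<close> and not passed as an argument, so
  the reward atoms always fit \<open>I\<close>.\<close>

definition extend :: "nat \<Rightarrow> ('c, 'v) tatm set \<Rightarrow> ('c, 'v) assign \<Rightarrow> ('c, 'v) assign \<Rightarrow> ('c, 'v) assign
    \<Rightarrow> ('c, 'v) tatm set" where
  "extend m I e f s' = I \<union> stamp m e \<union> stamp m f \<union> stamp (Suc m) s' \<union> rewards m (part D (fl D) I m) e s'"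

lemma rewards_uatoms: "rewards i s e s' \<subseteq> uatoms i"
  unfolding rewards_def uatoms_def by blast

lemma eq_notin_rewards [simp]: "Eq k v \<notin> rewards i s e s'"
  unfolding rewards_def by auto

lemma static_rules_sat:
  "(\<forall>R\<in>static_rules i. sat I R) \<longleftrightarrow>
     (\<forall>F G. (F, G) \<in> static_laws D \<longrightarrow> sat (part D (fl D) I i) (rule F G))"
  unfolding static_rules_def using sat_stamp_part[OF static_over(1)] sat_stamp_part[OF static_over(2)]
  by fastforce

lemma static_rules_reduct:
  "(\<forall>R\<in>static_rules i. sat J (reduct I R)) \<longleftrightarrow>
     (\<forall>F G. (F, G) \<in> static_laws D \<longrightarrow> sat (part D (fl D) J i) (reduct (part D (fl D) I i) (rule F G)))"
proof -
  have "sat J (reduct I (rule (stamp_fm i F) (stamp_fm i G))) \<longleftrightarrow>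
      sat (part D (fl D) J i) (reduct (part D (fl D) I i) (rule F G))" if "(F, G) \<in> static_laws D" for F G
  proof -
    have "rule (stamp_fm i F) (stamp_fm i G) = stamp_fm i (rule F G)" by (simp add: stamp_fm_def)
    moreover have "fm_over D (fl D) (rule F G)"
      using static_over[OF that] unfolding fm_over_def by simp
    ultimately show ?thesis using sat_reduct_stamp[of D "fl D" "rule F G" J I i] by metis
  qed
  then show ?thesis unfolding static_rules_def by blast
qed

lemma next_laws_static: "(F, G) \<in> static_laws D \<Longrightarrow> rule F G \<in> next_laws x"
  unfolding next_laws_def by blast

lemma next_laws_dynamic: "(F, G, H) \<in> dynamic_laws D \<Longrightarrow> sat x H \<Longrightarrow> rule F G \<in> next_laws x"
  unfolding next_laws_def by blast

lemma dynamic_rules_sat: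
  "(\<forall>R\<in>dynamic_rules i. sat I R) \<longleftrightarrow> (\<forall>F G H. (F, G, H) \<in> dynamic_laws D \<longrightarrow>
     sat (part D (fl D \<union> act D \<union> pf D) I i) H \<longrightarrow> sat (part D (fl D) I (Suc i)) (rule F G))"
proof -
  have "sat I (rule (stamp_fm (Suc i) F) (And (stamp_fm (Suc i) G) (stamp_fm i H))) \<longleftrightarrow>
      (sat (part D (fl D \<union> act D \<union> pf D) I i) H \<longrightarrow> sat (part D (fl D) I (Suc i)) (rule F G))"
    if "(F, G, H) \<in> dynamic_laws D" for F G H
    using sat_stamp_part[OF dynamic_over(2)[OF that], of I "Suc i"]
      sat_stamp_part[OF dynamic_over(3)[OF that], of I "Suc i"]
      sat_stamp_part[OF dynamic_over(4)[OF that], of I i] by auto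
  then show ?thesis unfolding dynamic_rules_def by blast
qed

text \<open>As \<open>J\<close> and \<open>I\<close> agree on slice \<open>i\<close>, the reduct of
  \<open>H\<close> holds in \<open>J\<close> exactly if \<open>H\<close> holds in slice
  \<open>i\<close> of \<open>I\<close>. What remains is the reduct of the activated part of the
  law.\<close>

lemma dynamic_rules_reduct:
  assumes "part D (fl D \<union> act D \<union> pf D) J i = part D (fl D \<union> act D \<union> pf D) I i"
    and "\<forall>R\<in>dynamic_rules i. sat I R"
  shows "(\<forall>R\<in>dynamic_rules i. sat J (reduct I R)) \<longleftrightarrow> (\<forall>F G H. (F, G, H) \<in> dynamic_laws D \<longrightarrow>
     sat (part D (fl D \<union> act D \<union> pf D) I i) H \<longrightarrow>
     sat (part D (fl D) J (Suc i)) (reduct (part D (fl D) I (Suc i)) (rule F G)))"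
proof -
  have "sat J (reduct I (rule (stamp_fm (Suc i) F) (And (stamp_fm (Suc i) G) (stamp_fm i H)))) \<longleftrightarrow>
      (sat (part D (fl D \<union> act D \<union> pf D) I i) H \<longrightarrow>
        sat (part D (fl D) J (Suc i)) (reduct (part D (fl D) I (Suc i)) (rule F G)))"
    if l: "(F, G, H) \<in> dynamic_laws D" for F G H
  proof -
    let ?F = "stamp_fm (Suc i) F" and ?G = "stamp_fm (Suc i) G" and ?H = "stamp_fm i H"
    have R: "sat I (rule ?F (And ?G ?H))" using assms(2) l unfolding dynamic_rules_def by blast
    have H: "sat J (reduct I ?H) \<longleftrightarrow> sat (part D (fl D \<union> act D \<union> pf D) I i) H"
      using sat_reduct_stamp[OF dynamic_over(4)[OF l], of J I i] assms(1) by simp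
    \<comment> \<open>If \<open>I\<close> falsified this part, its reduct would be
      \<open>Bot\<close> and not an implication; this is where the second assumption enters.\<close>
    have S: "sat (part D (fl D) I (Suc i)) (rule F G)"
      if "sat (part D (fl D \<union> act D \<union> pf D) I i) H"
      using assms(2) l that unfolding dynamic_rules_sat by blast
    show ?thesis
      using S unfolding sat_reduct_Imp[OF R] sat_reduct_And H
        sat_reduct_stamp[OF dynamic_over(2)[OF l]] sat_reduct_stamp[OF dynamic_over(3)[OF l]]
      by auto
  qed
  then show ?thesis unfolding dynamic_rules_def by blast
qed

lemma utility_rules_sat:
  "(\<forall>R\<in>utility_rules i. sat I R) \<longleftrightarrow>
     rewards i (part D (fl D) I i) (part D (act D) I i) (part D (fl D) I (Suc i)) \<subseteq> I"
proof -
  have "sat I (rule (Atom A) (And (stamp_fm (Suc i) F) (stamp_fm i G))) \<longleftrightarrow>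
      (sat (part D (fl D) I (Suc i)) F \<and> sat (part D (fl D) I i \<union> part D (act D) I i) G \<longrightarrow> A \<in> I)"
    if "(v, F, G) \<in> utility_laws D" for A v F G
    using sat_stamp_part[OF utility_over(1)[OF that], of I "Suc i"]
      sat_stamp_part[OF utility_over(2)[OF that], of I i] by (simp add: part_Un)
  then show ?thesis unfolding utility_rules_def rewards_def by blast
qed

lemma SM_unique:
  assumes "I \<in> SM (prog b m)" "(i, c) \<in> consts_of b m"
  shows "\<exists>!v. v \<in> vals D c \<and> Eq (i, c) v \<in> I"
proof -
  have "\<forall>k\<in>consts_of b m. \<exists>!v. v \<in> vals D (snd k) \<and> Eq k v \<in> I"
    using assms(1) unfolding SM_prog_iff by (elim conjE)
  from bspec[OF this assms(2)] show ?thesis by simp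
qed

lemma SM_sat: "I \<in> SM (prog b m) \<Longrightarrow> R \<in> rules b m \<Longrightarrow> sat I R"
  unfolding SM_prog_iff by (elim conjE) (rule bspec)

lemma SM_minimal:
  assumes "I \<in> SM (prog b m)" "J \<subseteq> I"
    and "\<And>k v. \<lbrakk>k \<in> pconsts_of b m; v \<in> vals D (snd k); Eq k v \<in> I\<rbrakk> \<Longrightarrow> Eq k v \<in> J"
    and "\<And>R. R \<in> rules b m \<Longrightarrow> sat J (reduct I R)"
  shows "J = I"
proof -
  have "\<forall>J\<subseteq>I. (\<forall>k\<in>pconsts_of b m. \<forall>v\<in>vals D (snd k). Eq k v \<in> I \<longrightarrow> Eq k v \<in> J) \<and>
        (\<forall>R\<in>rules b m. sat J (reduct I R)) \<longrightarrow> J = I"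
    using assms(1) unfolding SM_prog_iff by (elim conjE)
  then show ?thesis using assms(2-4) by simp
qed

lemma SM_progI:
  assumes "\<And>R. R \<in> rules b m \<Longrightarrow> sat I R"
    and "\<And>i c. (i, c) \<in> consts_of b m \<Longrightarrow> \<exists>!v. v \<in> vals D c \<and> Eq (i, c) v \<in> I"
    and "\<And>J. \<lbrakk>J \<subseteq> I;
      \<And>k v. \<lbrakk>k \<in> pconsts_of b m; v \<in> vals D (snd k); Eq k v \<in> I\<rbrakk> \<Longrightarrow> Eq k v \<in> J;
      \<And>R. R \<in> rules b m \<Longrightarrow> sat J (reduct I R)\<rbrakk> \<Longrightarrow> J = I"
  shows "I \<in> SM (prog b m)"
  unfolding SM_prog_iff
proof (intro conjI ballI allI impI)
  show "\<exists>!v. v \<in> vals D (snd k) \<and> Eq k v \<in> I" if "k \<in> consts_of b m" for k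
    using assms(2) that by (cases k) simp
qed (use assms(1,3) in auto)

lemma part_Int_sig: "C \<subseteq> {c. (i, c) \<in> consts_of b m} \<Longrightarrow> part D C (K \<inter> sig b m) i = part D C K i"
  unfolding part_def proj_def atoms_over_def by (auto simp: eq_in_sig)

lemma part_assigns:
  assumes I: "I \<in> SM (prog b m)" and C: "{i} \<times> C \<subseteq> consts_of b m"
  shows "part D C I i \<in> assigns D C"
proof -
  have "\<exists>!v. (c, v) \<in> part D C I i" if "c \<in> C" for c
  proof -
    have "\<exists>!v. v \<in> vals D c \<and> Eq (i, c) v \<in> I"
      using SM_unique[OF I] C that by blast
    then show ?thesis using that by (simp add: in_part conj_commute)
  qed
  then show ?thesis unfolding assigns_def part_def by blast
qed

lemma assigns_subset: "s \<in> assigns D C \<Longrightarrow> s \<subseteq> atoms_over D C"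
  unfolding assigns_def by blast

text \<open>Both are graphs of functions defined on all of \<open>C\<close>.\<close>

lemma assigns_subset_eq:
  assumes "s \<in> assigns D C" "t \<in> assigns D C" "s \<subseteq> t" shows "s = t"
proof
  show "t \<subseteq> s"
  proof
    fix x assume x: "x \<in> t"
    obtain c v where cv: "x = (c, v)" by (cases x)
    then have c: "c \<in> C" using x assms(2) unfolding assigns_def atoms_over_def by auto
    then obtain w where "(c, w) \<in> s" using assms(1) unfolding assigns_def by blast
    moreover have "(c, w) = (c, v)" using c calculation assms(2,3) x cv unfolding assigns_def by blast
    ultimately show "x \<in> s" using cv by simp
  qed
qed (rule assms(3))

section \<open>Restricting a stable model to fewer steps and analysing its last layer\<close>

lemma pconst_in_layer: "c \<in> pf D \<Longrightarrow> v \<in> vals D c \<Longrightarrow> Eq (m, c) v \<in> layer m"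
  by (simp add: eq_in_layer layer_consts_iff)

text \<open>A competitor for the restriction, completed by all layer atoms of \<open>K\<close>, is a
  competitor for \<open>K\<close>: old rules do not see the layer, and the heads of the layer rules
  are untouched.\<close>

lemma SM_restrict:
  assumes K: "K \<in> SM (prog b (Suc m))" shows "K \<inter> sig b m \<in> SM (prog b m)"
proof -
  let ?I = "K \<inter> sig b m"
  have agree: "sat K R = sat ?I R" "reduct K R = reduct ?I R" if "R \<in> rules b m" for R
    using rules_atoms[OF that] by (auto intro!: sat_cong reduct_cong)
  have s: "sat ?I R" if "R \<in> rules b m" for R
    using SM_sat[OF K] agree(1)[OF that] that by simp
  have u: "\<exists>!v. v \<in> vals D c \<and> Eq (i, c) v \<in> ?I" if "(i, c) \<in> consts_of b m" for i c
  proof -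
    have "\<exists>!v. v \<in> vals D c \<and> Eq (i, c) v \<in> K"
      using SM_unique[OF K] that by simp
    moreover have "v \<in> vals D c \<Longrightarrow> Eq (i, c) v \<in> sig b m" for v
      using that by (simp add: eq_in_sig)
    ultimately show ?thesis by blast
  qed
  have min: "J = ?I"
    if J: "J \<subseteq> ?I" and p: "\<And>k v. \<lbrakk>k \<in> pconsts_of b m; v \<in> vals D (snd k); Eq k v \<in> ?I\<rbrakk> \<Longrightarrow> Eq k v \<in> J"
      and r: "\<And>R. R \<in> rules b m \<Longrightarrow> sat J (reduct ?I R)" for J
  proof -
    define J' where "J' = J \<union> (K \<inter> layer m)"
    have J'K: "J' \<subseteq> K" using J unfolding J'_def by blast
    have "Eq k v \<in> J'" if "k \<in> pconsts_of b (Suc m)" "v \<in> vals D (snd k)" "Eq k v \<in> K" for k v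
    proof (cases "k \<in> pconsts_of b m")
      case True
      then have "Eq k v \<in> sig b m"
        using pconsts_of_subset[of b m] that(2) by (cases k) (auto simp: eq_in_sig)
      then show ?thesis using p[OF True] that unfolding J'_def by blast
    next
      case False
      then show ?thesis using that pconst_in_layer unfolding J'_def by auto
    qed
    moreover have "sat J' (reduct K R)" if R: "R \<in> rules b (Suc m)" for R
    proof (cases "R \<in> rules b m")
      case True
      have "sat J' (reduct ?I R) = sat J (reduct ?I R)"
        using rules_atoms[OF True] set_fm_reduct[of ?I R] sig_layer_disjoint[of b m]
        unfolding J'_def by (intro sat_cong) blast
      then show ?thesis using r True agree(2)[OF True] by simp
    next
      case False
      then have "R \<in> layer_rules m" using R by simp
      then obtain F G where "R = Imp G F" "set_fm F \<subseteq> layer m"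
        using layer_rules_heads by blast
      moreover have "sat K R" by (rule SM_sat[OF K R])
      moreover have "a \<in> K \<longleftrightarrow> a \<in> J'" if "a \<in> layer m" for a
        using that J'K unfolding J'_def by blast
      ultimately show ?thesis using sat_reduct_head[of K G F J'] by blast
    qed
    ultimately have "J' = K" using SM_minimal[OF K J'K] by blast
    then show ?thesis using J sig_layer_disjoint[of b m] unfolding J'_def by blast
  qed
  show ?thesis by (rule SM_progI; (fact s | fact u | fact min))
qed

text \<open>Utility atoms occur only in heads of utility rules. Deleting those without a satisfied
  body therefore preserves every reduct, and minimality shows that there are none.\<close>

lemma SM_utilities:
  assumes K: "K \<in> SM (prog b (Suc m))"
  shows "K \<inter> uatoms m =
    rewards m (part D (fl D) K m) (part D (act D) K m) (part D (fl D) K (Suc m))"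
    (is "_ = ?U")
proof
  show "?U \<subseteq> K \<inter> uatoms m"
    using SM_sat[OF K] rewards_uatoms utility_rules_sat[of m K] by (simp add: layer_rules_def)
  define J where "J = K - (uatoms m - ?U)"
  have eq: "Eq k v \<in> K \<longleftrightarrow> Eq k v \<in> J" for k v unfolding J_def uatoms_def by auto
  have par: "part D C J i = part D C K i" for C i unfolding part_def proj_def eq[symmetric] ..
  have "sat J (reduct K R)" if R: "R \<in> rules b (Suc m)" for R
  proof (cases "R \<in> utility_rules m")
    case True
    then obtain v F G where l: "(v, F, G) \<in> utility_laws D"
      "R = rule (Atom (Utility v [Suc m, uid D (v, F, G)])) (And (stamp_fm (Suc m) F) (stamp_fm m G))"
      unfolding utility_rules_def by blast
    have s: "sat K R" by (rule SM_sat[OF K R])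
    show ?thesis
    proof (cases "sat K (And (stamp_fm (Suc m) F) (stamp_fm m G))")
      case True
      then have "Utility v [Suc m, uid D (v, F, G)] \<in> ?U"
        using sat_stamp_part[OF utility_over(1)[OF l(1)], of K "Suc m"]
          sat_stamp_part[OF utility_over(2)[OF l(1)], of K m] l(1)
        unfolding rewards_def by (auto simp: part_Un)
      then show ?thesis using s l(2) True unfolding J_def by auto
    next
      case False
      then show ?thesis using s reduct_unsat[OF False] unfolding l(2) by simp
    qed
  next
    case False
    have "set_fm R \<inter> uatoms m = {}"
    proof (cases "R \<in> rules b m")
      case True
      then show ?thesis using rules_atoms[OF True] sig_layer_disjoint[of b m] unfolding layer_def by blast
    next
      case n: False
      have "Utility u t \<notin> set_fm R" for u t
        using R n False
        unfolding static_rules_def dynamic_rules_def action_rules_def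
        by (auto simp: layer_rules_def static_rules_def dynamic_rules_def action_rules_def set_fm_stamp)
      then show ?thesis unfolding uatoms_def by auto
    qed
    then have "sat J (reduct K R) = sat K R"
      unfolding J_def by (intro sat_reduct_agree) blast
    then show ?thesis using SM_sat[OF K R] by simp
  qed
  moreover have "J \<subseteq> K" unfolding J_def by blast
  ultimately have "J = K" using SM_minimal[OF K] eq by blast
  then show "K \<inter> uatoms m \<subseteq> ?U" unfolding J_def by blast
qed

lemma layer_fl_consts: "{Suc m} \<times> fl D \<subseteq> consts_of b (Suc m)" "{m} \<times> act D \<subseteq> consts_of b (Suc m)"
  "{m} \<times> pf D \<subseteq> consts_of b (Suc m)"
  by (auto simp: layer_consts_def)

text \<open>A smaller reduct model of the activated laws lifts to one of the whole program by
  deleting the corresponding fluent atoms at time \<open>Suc m\<close>; minimality of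
  \<open>K\<close> forbids it.\<close>

lemma SM_step:
  assumes K: "K \<in> SM (prog b (Suc m))"
  shows "step (part D (fl D) K m) (part D (act D) K m) (part D (pf D) K m) (part D (fl D) K (Suc m))"
proof -
  let ?s = "part D (fl D) K m" and ?e = "part D (act D) K m" and ?f = "part D (pf D) K m"
    and ?s' = "part D (fl D) K (Suc m)"
  have x: "part D (fl D \<union> act D \<union> pf D) K m = ?s \<union> ?e \<union> ?f" by (simp add: part_Un)
  have Ks: "sat K R" if "R \<in> rules b (Suc m)" for R by (rule SM_sat[OF K that])
  have dyn: "\<forall>R\<in>dynamic_rules m. sat K R" using Ks by (auto simp: layer_rules_def)
  have "sat ?s' R" if "R \<in> next_laws (?s \<union> ?e \<union> ?f)" for R
  proof -
    have "\<forall>R\<in>static_rules (Suc m). sat K R" using Ks by (auto simp: layer_rules_def)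
    then show ?thesis
      using that dyn unfolding next_laws_def static_rules_sat dynamic_rules_sat x by blast
  qed
  moreover have "t = ?s'"
    if t: "t \<subseteq> ?s'" and c: "\<forall>R\<in>next_laws (?s \<union> ?e \<union> ?f). sat t (reduct ?s' R)" for t
  proof -
    \<comment> \<open>The deleted atoms are fluents at the last time, hence not probabilistic; slice
      \<open>m\<close> is unchanged, as \<open>dynamic_rules_reduct\<close> requires.\<close>
    define J where "J = K - stamp (Suc m) (?s' - t)"
    have pJ: "part D (fl D) J (Suc m) = t"
      using t unfolding J_def by (auto simp: in_part in_stamp)
    have x': "part D (fl D \<union> act D \<union> pf D) J m = part D (fl D \<union> act D \<union> pf D) K m"
      unfolding J_def by (auto simp: in_part in_stamp)
    have ly: "stamp (Suc m) (?s' - t) \<subseteq> eqs ({Suc m} \<times> fl D)"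
      by (rule stamp_subset_eqs[of _ "fl D"]) (auto simp: part_def)
    have "Eq k v \<in> J" if "k \<in> pconsts_of b (Suc m)" "Eq k v \<in> K" for k v
    proof -
      have "k \<notin> {Suc m} \<times> fl D"
        using that(1) disjoint_sorts
        by (cases b) (auto simp: pconsts_of_False pconsts_of_True)
      then show ?thesis using that(2) ly unfolding J_def by (auto simp: in_eqs dest!: subsetD)
    qed
    moreover have "sat J (reduct K R)" if R: "R \<in> rules b (Suc m)" for R
    proof -
      have agree: ?thesis if "set_fm R \<inter> eqs ({Suc m} \<times> fl D) = {}"
        using sat_reduct_agree[of R K J] that ly Ks[OF R] unfolding J_def by blast
      from R have "R \<in> rules b m \<union> layer_rules m" by simp
      then consider "R \<in> rules b m" | "R \<in> static_rules (Suc m)" | "R \<in> dynamic_rules m"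
        | "R \<in> action_rules m" | "R \<in> utility_rules m" unfolding layer_rules_def by blast
      then show ?thesis
      proof cases
        case 1
        have "eqs ({Suc m} \<times> fl D) \<subseteq> layer m"
          unfolding layer_def layer_consts_def eqs_def by blast
        then show ?thesis using agree rules_atoms[OF 1] sig_layer_disjoint[of b m] by blast
      next
        case 2
        have "\<forall>R\<in>static_rules (Suc m). sat J (reduct K R)"
          using c next_laws_static unfolding static_rules_reduct pJ by blast
        then show ?thesis using 2 by blast
      next
        case 3
        have "\<forall>R\<in>dynamic_rules m. sat J (reduct K R)"
          unfolding dynamic_rules_reduct[OF x' dyn] pJ x using c next_laws_dynamic by blast
        then show ?thesis using 3 by blast
      next
        case 4
        then show ?thesis by (intro agree) (auto simp: action_rules_def in_eqs)
      next
        case 5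
        then obtain v F G where l: "(v, F, G) \<in> utility_laws D"
          "R = rule (Atom (Utility v [Suc m, uid D (v, F, G)])) (And (stamp_fm (Suc m) F) (stamp_fm m G))"
          unfolding utility_rules_def by blast
        \<comment> \<open>The body may lose atoms here, but the head is a utility atom and is
          kept.\<close>
        then show ?thesis using Ks[OF R] unfolding l(2)
          by (intro sat_reduct_head) (auto simp: J_def)
      qed
    qed
    moreover have "J \<subseteq> K" unfolding J_def by blast
    ultimately have "J = K" using SM_minimal[OF K] by blast
    then have "stamp (Suc m) (?s' - t) \<inter> K = {}" unfolding J_def by blast
    moreover have "stamp (Suc m) (?s' - t) \<subseteq> K" unfolding stamp_def part_def proj_def by auto
    ultimately have "stamp (Suc m) (?s' - t) = {}" by blast
    then show ?thesis using t unfolding stamp_def by blast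
  qed
  ultimately have "stable_model (next_laws (?s \<union> ?e \<union> ?f)) ?s'" unfolding stable_model_iff by blast
  then show ?thesis unfolding step_def
    using part_assigns[OF K layer_fl_consts(1)] part_assigns[OF K layer_fl_consts(2)]
      part_assigns[OF K layer_fl_consts(3)] by simp
qed

section \<open>Composing a stable model with a step\<close>

lemma part_sig: "part D (fl D) (K \<inter> sig b m) m = part D (fl D) K m"
  by (rule part_Int_sig) (auto simp: consts_of_iff)

text \<open>The value atoms of the new layer are the three slices, and its utility atoms are forced
  by \<open>SM_utilities\<close>. The decomposition thus loses nothing, which gives surjectivity of
  the bijections between runs.\<close>

lemma SM_extend_eq:
  assumes K: "K \<in> SM (prog b (Suc m))"
  shows "K = extend m (K \<inter> sig b m) (part D (act D) K m) (part D (pf D) K m) (part D (fl D) K (Suc m))"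
proof -
  have "K \<inter> eqs (layer_consts m) =
      stamp m (part D (act D) K m) \<union> stamp m (part D (pf D) K m) \<union> stamp (Suc m) (part D (fl D) K (Suc m))"
    (is "?L = ?R")
  proof (rule set_eqI)
    fix a show "a \<in> ?L \<longleftrightarrow> a \<in> ?R"
    proof (cases a)
      case (Eq k v)
      then show ?thesis by (cases k) (auto simp: in_eqs in_stamp in_part layer_consts_iff)
    qed (auto simp: in_eqs)
  qed
  then show ?thesis
    using SM_prog_subset[OF K] SM_utilities[OF K]
    unfolding extend_def sig_Suc layer_def part_sig by blast
qed

lemma extend_parts:
  assumes I: "I \<subseteq> sig b m" and e: "e \<subseteq> atoms_over D (act D)" and f: "f \<subseteq> atoms_over D (pf D)"
    and s': "s' \<subseteq> atoms_over D (fl D)"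
  shows "extend m I e f s' \<inter> sig b m = I" "extend m I e f s' \<subseteq> sig b (Suc m)"
    "i \<le> m \<Longrightarrow> part D (fl D) (extend m I e f s') i = part D (fl D) I i"
    "part D (fl D) (extend m I e f s') (Suc m) = s'"
    "i < m \<Longrightarrow> part D (act D) (extend m I e f s') i = part D (act D) I i"
    "part D (act D) (extend m I e f s') m = e"
    "part D (pf D) (extend m I e f s') m = f"
    "part D (fl D \<union> act D \<union> pf D) (extend m I e f s') m = part D (fl D) I m \<union> e \<union> f"
    "extend m I e f s' \<inter> uatoms m = rewards m (part D (fl D) I m) e s'"
proof -
  let ?K = "extend m I e f s'"
  have new: "stamp m e \<union> stamp m f \<union> stamp (Suc m) s' \<subseteq> eqs (layer_consts m)"
    using stamp_subset_eqs[OF e, of m "layer_consts m"] stamp_subset_eqs[OF f, of m "layer_consts m"]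
      stamp_subset_eqs[OF s', of "Suc m" "layer_consts m"] unfolding layer_consts_def by blast
  then have "?K - I \<subseteq> layer m" unfolding extend_def layer_def using rewards_uatoms by blast
  then show "?K \<inter> sig b m = I" "?K \<subseteq> sig b (Suc m)"
    using I sig_layer_disjoint[of b m] unfolding sig_Suc extend_def by blast+
  \<comment> \<open>The strict bound for actions and pf constants ensures that \<open>I\<close>
    contributes nothing to these sorts at time \<open>m\<close>, so that exactly \<open>e\<close>
    and \<open>f\<close> are read back.\<close>
  have inI: "Eq (i, c) v \<in> I \<Longrightarrow>
      i \<le> m \<and> c \<in> fl D \<or> i < m \<and> c \<in> act D \<union> pf D \<or> b \<and> i = 0 \<and> c \<in> initpf D" for i c v
    using I eq_in_sig consts_of_iff by blast
  have ine: "c \<in> act D \<and> v \<in> vals D c" if "(c, v) \<in> e" for c v using that e unfolding atoms_over_def by auto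
  have inf: "c \<in> pf D \<and> v \<in> vals D c" if "(c, v) \<in> f" for c v using that f unfolding atoms_over_def by auto
  have ins: "c \<in> fl D \<and> v \<in> vals D c" if "(c, v) \<in> s'" for c v using that s' unfolding atoms_over_def by auto
  have inK: "Eq (i, c) v \<in> ?K \<longleftrightarrow> Eq (i, c) v \<in> I \<or> i = m \<and> (c, v) \<in> e \<or> i = m \<and> (c, v) \<in> f \<or>
      i = Suc m \<and> (c, v) \<in> s'" for i c v
    unfolding extend_def by (auto simp: in_stamp)
  have ds: "\<not> (c \<in> fl D \<and> c \<in> act D)" "\<not> (c \<in> fl D \<and> c \<in> pf D)" "\<not> (c \<in> fl D \<and> c \<in> initpf D)"
    "\<not> (c \<in> act D \<and> c \<in> pf D)" "\<not> (c \<in> act D \<and> c \<in> initpf D)" "\<not> (c \<in> pf D \<and> c \<in> initpf D)" for c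
    using disjoint_sorts by blast+
  have "(c, v) \<in> part D (fl D) ?K i \<longleftrightarrow> (c, v) \<in> part D (fl D) I i" if "i \<le> m" for i c v
    unfolding in_part inK using that ine[of c v] inf[of c v] ds[of c] by auto
  then show *: "part D (fl D) ?K i = part D (fl D) I i" if "i \<le> m" for i using that by auto
  have "(c, v) \<in> part D (fl D) ?K (Suc m) \<longleftrightarrow> (c, v) \<in> s'" for c v
    unfolding in_part inK using ins[of c v] ds[of c] inI[of "Suc m" c v] by auto
  then show "part D (fl D) ?K (Suc m) = s'" by auto
  have "(c, v) \<in> part D (act D) ?K i \<longleftrightarrow> (c, v) \<in> part D (act D) I i" if "i < m" for i c v
    unfolding in_part inK using that by auto
  then show "part D (act D) ?K i = part D (act D) I i" if "i < m" for i using that by auto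
  have "(c, v) \<in> part D (act D) ?K m \<longleftrightarrow> (c, v) \<in> e" for c v
    unfolding in_part inK using ine[of c v] inf[of c v] ds[of c] inI[of m c v] by auto
  then show e': "part D (act D) ?K m = e" by auto
  have "(c, v) \<in> part D (pf D) ?K m \<longleftrightarrow> (c, v) \<in> f" for c v
    unfolding in_part inK using ine[of c v] inf[of c v] ds[of c] inI[of m c v] by auto
  then show f': "part D (pf D) ?K m = f" by auto
  show "part D (fl D \<union> act D \<union> pf D) ?K m = part D (fl D) I m \<union> e \<union> f"
    unfolding part_Un e' f' *[OF order_refl] ..
  have "I \<inter> uatoms m = {}" using I sig_layer_disjoint[of b m] unfolding layer_def by blast
  moreover have "eqs (layer_consts m) \<inter> uatoms m = {}" unfolding uatoms_def by (auto simp: in_eqs)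
  ultimately show "?K \<inter> uatoms m = rewards m (part D (fl D) I m) e s'"
    using rewards_uatoms new unfolding extend_def by blast
qed

text \<open>A competitor is forced to be everything in turn: \<open>I\<close> by its own minimality,
  \<open>e\<close> by the choice rules, \<open>f\<close> by the soft rules, \<open>s'\<close> by
  stability under the activated laws, and the rewards by the utility rules.\<close>

lemma SM_extend:
  assumes I: "I \<in> SM (prog b m)" and st: "step (part D (fl D) I m) e f s'"
  shows "extend m I e f s' \<in> SM (prog b (Suc m))"
proof -
  let ?K = "extend m I e f s'" and ?s = "part D (fl D) I m"
  have e: "e \<in> assigns D (act D)" and f: "f \<in> assigns D (pf D)" and s': "s' \<in> assigns D (fl D)"
    and sm: "stable_model (next_laws (?s \<union> e \<union> f)) s'"
    using st unfolding step_def by auto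
  have Isig: "I \<subseteq> sig b m" by (rule SM_prog_subset[OF I])
  note P = extend_parts[OF Isig assigns_subset[OF e] assigns_subset[OF f] assigns_subset[OF s']]
  have agree: "sat ?K R = sat I R" "reduct ?K R = reduct I R" if "R \<in> rules b m" for R
    using rules_atoms[OF that] P(1) by (auto intro!: sat_cong reduct_cong)
  have dyn: "\<forall>R\<in>dynamic_rules m. sat ?K R"
    unfolding dynamic_rules_sat P(8) P(4) using sm next_laws_dynamic unfolding stable_model_iff by blast
  have sat: "sat ?K R" if R: "R \<in> rules b (Suc m)" for R
  proof -
    from R have "R \<in> rules b m \<union> layer_rules m" by simp
    then consider "R \<in> rules b m" | "R \<in> static_rules (Suc m)" | "R \<in> dynamic_rules m"
        | "R \<in> action_rules m" | "R \<in> utility_rules m" unfolding layer_rules_def by blast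
    then show ?thesis
    proof cases
      case 1
      then show ?thesis using agree(1)[OF 1] SM_sat[OF I 1] by simp
    next
      case 2
      have "\<forall>R\<in>static_rules (Suc m). sat ?K R"
        unfolding static_rules_sat P(4) using sm next_laws_static unfolding stable_model_iff by blast
      then show ?thesis using 2 by blast
    next
      case 3
      then show ?thesis using dyn by blast
    next
      case 4
      then show ?thesis unfolding action_rules_def by auto
    next
      case 5
      have "\<forall>R\<in>utility_rules m. sat ?K R"
        unfolding utility_rules_sat P(4) P(6) P(3)[OF order_refl] unfolding extend_def by blast
      then show ?thesis using 5 by blast
    qed
  qed
  have uniq: "\<exists>!v. v \<in> vals D c \<and> Eq (i, c) v \<in> ?K" if "(i, c) \<in> consts_of b (Suc m)" for i c
  proof -
    have new: "\<exists>!v. v \<in> vals D c \<and> Eq (i, c) v \<in> ?K"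
      if "part D C ?K i \<in> assigns D C" "c \<in> C" for C
    proof -
      have "\<exists>!v. (c, v) \<in> part D C ?K i" using that unfolding assigns_def by blast
      then show ?thesis using that(2) by (simp add: in_part conj_commute)
    qed
    from that consider "(i, c) \<in> consts_of b m" | "i = Suc m" "c \<in> fl D" | "i = m" "c \<in> act D"
      | "i = m" "c \<in> pf D" by (auto simp: layer_consts_def)
    then show ?thesis
    proof cases
      case 1
      then have "\<exists>!v. v \<in> vals D c \<and> Eq (i, c) v \<in> I" by (rule SM_unique[OF I])
      moreover have "Eq (i, c) v \<in> ?K \<longleftrightarrow> Eq (i, c) v \<in> I" if "v \<in> vals D c" for v
        using P(1) 1 that eq_in_sig by blast
      ultimately show ?thesis by blast
    next
      case 2 then show ?thesis using new[of "fl D"] s' P(4) by simp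
    next
      case 3 then show ?thesis using new[of "act D"] e P(6) by simp
    next
      case 4 then show ?thesis using new[of "pf D"] f P(7) by simp
    qed
  qed
  have min: "J = ?K"
    if J: "J \<subseteq> ?K"
      and p: "\<And>k v. \<lbrakk>k \<in> pconsts_of b (Suc m); v \<in> vals D (snd k); Eq k v \<in> ?K\<rbrakk> \<Longrightarrow> Eq k v \<in> J"
      and r: "\<And>R. R \<in> rules b (Suc m) \<Longrightarrow> sat J (reduct ?K R)" for J
  proof -
    have "J \<inter> sig b m = I"
    proof -
      have "Eq k v \<in> J \<inter> sig b m" if "k \<in> pconsts_of b m" "v \<in> vals D (snd k)" "Eq k v \<in> I" for k v
      proof -
        have "Eq k v \<in> ?K" "Eq k v \<in> sig b m" using that(3) P(1) by blast+
        then show ?thesis using p[of k v] that(1,2) by simp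
      qed
      moreover have "sat (J \<inter> sig b m) (reduct I R)" if R: "R \<in> rules b m" for R
      proof -
        have "sat (J \<inter> sig b m) (reduct ?K R) = sat J (reduct ?K R)"
          using rules_atoms[OF R] set_fm_reduct[of ?K R] by (intro sat_cong) blast
        then show ?thesis using r[of R] R agree(2)[OF R] by simp
      qed
      moreover have "J \<inter> sig b m \<subseteq> I" using J P(1) by blast
      ultimately show ?thesis using SM_minimal[OF I] by blast
    qed
    then have IJ: "I \<subseteq> J" by blast
    have eJ: "stamp m e \<subseteq> J"
    proof
      fix a assume a: "a \<in> stamp m e"
      then obtain c v where a': "a = Eq (m, c) v" "(c, v) \<in> e" unfolding stamp_def by auto
      then have c: "c \<in> act D" "v \<in> vals D c" using assigns_subset[OF e] unfolding atoms_over_def by auto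
      then obtain x where "v = BVal x" using vals_act by auto
      then have "choice a \<in> rules b (Suc m)"
        using c(1) a'(1) unfolding rules.simps layer_rules_def action_rules_def by blast
      then have "sat J (reduct ?K (choice a))" using r by blast
      moreover have "a \<in> ?K" using a unfolding extend_def by blast
      ultimately show "a \<in> J" unfolding sat_reduct_choice by blast
    qed
    have fJ: "stamp m f \<subseteq> J"
    proof
      fix a assume a: "a \<in> stamp m f"
      then obtain c v where a': "a = Eq (m, c) v" "(c, v) \<in> f" unfolding stamp_def by auto
      then have "c \<in> pf D" "v \<in> vals D c" using assigns_subset[OF f] unfolding atoms_over_def by auto
      moreover have "a \<in> ?K" using a unfolding extend_def by blast
      ultimately show "a \<in> J" using p a'(1) by auto
    qed
    have "part D C I m \<subseteq> part D C J m" for C using IJ unfolding part_def proj_def by blast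
    moreover have mono: "part D C J i \<subseteq> part D C ?K i" for C i using J unfolding part_def proj_def by blast
    moreover have "e \<subseteq> part D (act D) J m"
      using eJ assigns_subset[OF e] unfolding part_def proj_def stamp_def by fastforce
    moreover have "f \<subseteq> part D (pf D) J m"
      using fJ assigns_subset[OF f] unfolding part_def proj_def stamp_def by fastforce
    ultimately have ps: "part D (fl D) J m = ?s" and pe: "part D (act D) J m = e"
        and pf: "part D (pf D) J m = f"
      using P(3)[OF order_refl] P(6,7) by blast+
    \<comment> \<open>Only now, with the whole slice \<open>m\<close> of \<open>J\<close> fixed, can
      the dynamic rules be read as the activated laws.\<close>
    have x': "part D (fl D \<union> act D \<union> pf D) J m = part D (fl D \<union> act D \<union> pf D) ?K m"
      unfolding P(8) unfolding part_Un ps pe pf ..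
    let ?t = "part D (fl D) J (Suc m)"
    have ps': "?t = s'"
    proof -
      have "?t \<subseteq> s'" using mono[of "fl D" "Suc m"] P(4) by simp
      moreover have "sat ?t (reduct s' R)" if R: "R \<in> next_laws (?s \<union> e \<union> f)" for R
      proof -
        have "\<forall>R\<in>static_rules (Suc m). sat J (reduct ?K R)" "\<forall>R\<in>dynamic_rules m. sat J (reduct ?K R)"
          using r unfolding rules.simps layer_rules_def by blast+
        then show ?thesis
          using R unfolding static_rules_reduct dynamic_rules_reduct[OF x' dyn] P(4) P(8) next_laws_def
          by blast
      qed
      ultimately show ?thesis using sm unfolding stable_model_iff by blast
    qed
    \<comment> \<open>The bodies of the utility rules lie in slices where \<open>J\<close> already
      equals the extension, so their reducts fire.\<close>
    have "rewards m ?s e s' \<subseteq> J"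
    proof
      fix a assume "a \<in> rewards m ?s e s'"
      then obtain v F G where a: "a = Utility v [Suc m, uid D (v, F, G)]" "(v, F, G) \<in> utility_laws D"
        "sat s' F" "sat (?s \<union> e) G" unfolding rewards_def by blast
      let ?R = "rule (Atom a) (And (stamp_fm (Suc m) F) (stamp_fm m G))"
      have "?R \<in> rules b (Suc m)"
        using a(1,2) unfolding rules.simps layer_rules_def utility_rules_def by blast
      then have R: "sat J (reduct ?K ?R)" "sat ?K ?R" using r sat by blast+
      have s1: "sat J (reduct ?K (stamp_fm (Suc m) F))"
        using sat_reduct_stamp[OF utility_over(1)[OF a(2)], of J ?K "Suc m"] ps' P(4) a(3) by simp
      have s2: "sat J (reduct ?K (stamp_fm m G))"
        using sat_reduct_stamp[OF utility_over(2)[OF a(2)], of J ?K m] ps pe P(3)[OF order_refl] P(6) a(4)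
        by (simp add: part_Un)
      have "sat J (reduct ?K (Atom a))"
        using R(1) s1 s2 unfolding sat_reduct_Imp[OF R(2)] sat_reduct_And by blast
      then show "a \<in> J" by (auto split: if_splits)
    qed
    moreover have "stamp (Suc m) s' \<subseteq> J"
      using ps' unfolding part_def proj_def stamp_def by auto
    ultimately show ?thesis using J IJ eJ fJ unfolding extend_def by blast
  qed
  show ?thesis by (rule SM_progI; (fact sat | fact uniq | fact min))
qed

section \<open>States, actions and transitions\<close>

lemma initial_choices_reduct:
  "(\<forall>R\<in>initial_choices. sat J (reduct I R)) \<longleftrightarrow>
    (\<forall>c v. c \<in> regular D \<longrightarrow> v \<in> vals D c \<longrightarrow> Eq (0, c) v \<in> I \<longrightarrow> Eq (0, c) v \<in> J)"
proof -
  have "(\<forall>R\<in>initial_choices. sat J (reduct I R)) \<longleftrightarrow>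
      (\<forall>c v. c \<in> regular D \<and> v \<in> vals D c \<longrightarrow> sat J (reduct I (choice (Eq (0, c) v))))"
    unfolding initial_choices_def by blast
  then show ?thesis unfolding sat_reduct_choice by blast
qed

lemma base_laws_reduct:
  "(\<forall>R\<in>base_laws. sat t (reduct s R)) \<longleftrightarrow>
    (\<forall>F G. (F, G) \<in> static_laws D \<longrightarrow> sat t (reduct s (rule F G))) \<and>
    (\<forall>c v. c \<in> regular D \<longrightarrow> v \<in> vals D c \<longrightarrow> (c, v) \<in> s \<longrightarrow> (c, v) \<in> t)"
proof -
  have "(\<forall>R\<in>base_laws. sat t (reduct s R)) \<longleftrightarrow>
      (\<forall>F G. (F, G) \<in> static_laws D \<longrightarrow> sat t (reduct s (rule F G))) \<and>
      (\<forall>c v. c \<in> regular D \<and> v \<in> vals D c \<longrightarrow> sat t (reduct s (choice (c, v))))"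
    unfolding base_laws_def by blast
  then show ?thesis unfolding sat_reduct_choice by blast
qed

lemma base_laws_sat:
  "(\<forall>R\<in>base_laws. sat s R) \<longleftrightarrow> (\<forall>F G. (F, G) \<in> static_laws D \<longrightarrow> sat s (rule F G))"
proof -
  have "sat s (choice a)" for a by simp
  then show ?thesis unfolding base_laws_def by blast
qed

text \<open>Deleting fluent atoms affects neither initpf atoms nor constraints with head
  \<open>Bot\<close>. So \<open>D_init\<close> may exclude states but creates no new ones.\<close>

lemma SM_base:
  assumes I: "I \<in> SM (prog b 0)"
  shows "stable_model base_laws (part D (fl D) I 0)"
proof -
  let ?s = "part D (fl D) I 0"
  have "\<forall>R\<in>static_rules 0. sat I R" using SM_sat[OF I] by simp
  then have "\<forall>R\<in>base_laws. sat ?s R" unfolding static_rules_sat base_laws_sat .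
  moreover have "t = ?s" if t: "t \<subseteq> ?s" and c: "\<forall>R\<in>base_laws. sat t (reduct ?s R)" for t
  proof -
    define J where "J = I - stamp 0 (?s - t)"
    have pJ: "part D (fl D) J 0 = t"
      using t unfolding J_def by (auto simp: in_part in_stamp)
    have JI: "J \<subseteq> I" unfolding J_def by blast
    have "Eq k v \<in> J" if k: "k \<in> pconsts_of b 0" "Eq k v \<in> I" for k v
    proof -
      obtain c where "k = (0, c)" "c \<in> initpf D" using k(1) by (auto split: if_splits)
      then show ?thesis using k(2) disjoint_sorts(3) unfolding J_def by (auto simp: in_stamp in_part)
    qed
    moreover have "sat J (reduct I R)" if R: "R \<in> rules b 0" for R
    proof -
      from R consider "R \<in> static_rules 0" | "R \<in> initial_choices" | "R \<in> initial_constraints"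
        by (auto split: if_splits)
      then show ?thesis
      proof cases
        case 1
        have "\<forall>R\<in>static_rules 0. sat J (reduct I R)"
          using c unfolding static_rules_reduct pJ base_laws_reduct by blast
        then show ?thesis using 1 by blast
      next
        case 2
        have "Eq (0, c) v \<in> J" if "c \<in> regular D" "v \<in> vals D c" "Eq (0, c) v \<in> I" for c v
        proof -
          have "(c, v) \<in> ?s" using that by (simp add: in_part fl_def)
          then have "(c, v) \<in> t" using c that unfolding base_laws_reduct by blast
          then show ?thesis using that(3) unfolding J_def by (simp add: in_stamp)
        qed
        then have "\<forall>R\<in>initial_choices. sat J (reduct I R)" unfolding initial_choices_reduct by blast
        then show ?thesis using 2 by blast
      next
        case 3
        then obtain G where G: "R = rule Bot G" unfolding initial_constraints_def by blast
        show ?thesis using SM_sat[OF I R] unfolding G by (rule sat_reduct_head) simp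
      qed
    qed
    ultimately have "J = I" using SM_minimal[OF I JI] by blast
    then show ?thesis using pJ by simp
  qed
  ultimately show ?thesis unfolding stable_model_iff by blast
qed

lemma part_stamp: "s \<subseteq> atoms_over D C \<Longrightarrow> part D C (stamp i s) i = s"
  by (auto simp: in_part in_stamp atoms_over_def)

text \<open>The converse is restricted to the program without \<open>D_init\<close>, whose initial
  laws may reject \<open>s\<close>.\<close>

lemma base_SM:
  assumes s: "s \<in> assigns D (fl D)" "stable_model base_laws s"
  shows "stamp 0 s \<in> SM (prog False 0)"
proof -
  have p: "part D (fl D) (stamp 0 s) 0 = s" using part_stamp[OF assigns_subset[OF s(1)]] .
  have sat: "sat (stamp 0 s) R" if R: "R \<in> rules False 0" for R
  proof -
    from R consider "R \<in> static_rules 0" | "R \<in> initial_choices" by auto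
    then show ?thesis
    proof cases
      case 1
      have "\<forall>R\<in>static_rules 0. sat (stamp 0 s) R"
        using s(2) unfolding static_rules_sat p stable_model_iff base_laws_sat by blast
      then show ?thesis using 1 by blast
    next
      case 2
      then show ?thesis unfolding initial_choices_def by auto
    qed
  qed
  have uniq: "\<exists>!v. v \<in> vals D c \<and> Eq (i, c) v \<in> stamp 0 s" if "(i, c) \<in> consts_of False 0" for i c
  proof -
    have i: "i = 0" "c \<in> fl D" using that by auto
    then have "\<exists>!v. (c, v) \<in> s" using s(1) unfolding assigns_def by blast
    moreover have "v \<in> vals D c" if "(c, v) \<in> s" for v
      using that assigns_subset[OF s(1)] unfolding atoms_over_def by auto
    ultimately show ?thesis unfolding in_stamp i(1) by blast
  qed
  have min: "J = stamp 0 s"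
    if J: "J \<subseteq> stamp 0 s"
      and "\<And>k v. \<lbrakk>k \<in> pconsts_of False 0; v \<in> vals D (snd k); Eq k v \<in> stamp 0 s\<rbrakk> \<Longrightarrow> Eq k v \<in> J"
      and r: "\<And>R. R \<in> rules False 0 \<Longrightarrow> sat J (reduct (stamp 0 s) R)" for J
  proof -
    let ?t = "part D (fl D) J 0"
    have "?t \<subseteq> s" using J by (auto simp: in_part in_stamp dest!: subsetD)
    moreover have "\<forall>R\<in>base_laws. sat ?t (reduct s R)"
    proof -
      have "\<forall>R\<in>static_rules 0. sat J (reduct (stamp 0 s) R)"
        "\<forall>R\<in>initial_choices. sat J (reduct (stamp 0 s) R)" using r by auto
      then show ?thesis
        unfolding static_rules_reduct initial_choices_reduct base_laws_reduct p in_stamp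
        by (auto simp: in_part fl_def)
    qed
    ultimately have "?t = s" using s(2) unfolding stable_model_iff by blast
    then have "stamp 0 s \<subseteq> J" unfolding stamp_def part_def proj_def by auto
    then show ?thesis using J by blast
  qed
  show ?thesis by (rule SM_progI; (fact sat | fact uniq | fact min))
qed

lemma Int_stamp: "K \<inter> stamp i (atoms_over D C) = stamp i (part D C K i)"
  unfolding stamp_def part_def proj_def by auto

lemma stamp_inject: "stamp i s = stamp i t \<longleftrightarrow> s = t"
  unfolding stamp_def by (rule inj_image_eq_iff) (auto simp: inj_on_def)

text \<open>Removes the residual quantifier over extensions and the stamps from the notion of
  state.\<close>

lemma states_iff: "s \<in> states D \<longleftrightarrow> s \<in> assigns D (fl D) \<and> stable_model base_laws s"
proof
  assume "s \<in> states D"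
  then obtain I where I: "I \<in> SM (prog False 0)" "I \<inter> stamp 0 (atoms_over D (fl D)) = stamp 0 s"
    unfolding states_def residual_stable_model_def D_m_eq by blast
  then have "part D (fl D) I 0 = s" unfolding Int_stamp stamp_inject by blast
  then show "s \<in> assigns D (fl D) \<and> stable_model base_laws s"
    using SM_base[OF I(1)] part_assigns[OF I(1), of 0 "fl D"] by auto
next
  assume s: "s \<in> assigns D (fl D) \<and> stable_model base_laws s"
  then have "stamp 0 s \<in> SM (D_m D 0)" using base_SM unfolding D_m_eq by blast
  moreover have "stamp 0 s \<inter> stamp 0 (atoms_over D (fl D)) = stamp 0 s"
    using s part_stamp[of s "fl D" 0] assigns_subset unfolding Int_stamp by metis
  ultimately show "s \<in> states D"
    using s assigns_subset unfolding states_def residual_stable_model_def by blast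
qed

lemma state_assigns: "s \<in> states D \<Longrightarrow> s \<in> assigns D (fl D)"
  using states_iff by blast

text \<open>The choice rules let a smaller model of the base reduct differ only on statically determined
  constants, which do not occur in the heads of dynamic laws.\<close>
lemma step_state:
  assumes st: "step s e f s'" shows "s' \<in> states D"
proof -
  have s': "s' \<in> assigns D (fl D)" and sm: "stable_model (next_laws (s \<union> e \<union> f)) s'"
    using st unfolding step_def by auto
  have sat: "sat s' R" if "R \<in> next_laws (s \<union> e \<union> f)" for R
    using sm that unfolding stable_model_iff by blast
  have "\<forall>R\<in>base_laws. sat s' R" using sat next_laws_static unfolding base_laws_sat by blast
  moreover have "t = s'" if t: "t \<subseteq> s'" and c: "\<forall>R\<in>base_laws. sat t (reduct s' R)" for t
  proof -
    have "sat t (reduct s' R)" if R: "R \<in> next_laws (s \<union> e \<union> f)" for R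
    proof -
      from R consider F G where "R = rule F G" "(F, G) \<in> static_laws D"
        | F G H where "R = rule F G" "(F, G, H) \<in> dynamic_laws D"
        unfolding next_laws_def by blast
      then show ?thesis
      proof cases
        case 1
        then show ?thesis using c unfolding base_laws_reduct by blast
      next
        case 2
        have "a \<in> s' \<longleftrightarrow> a \<in> t" if "a \<in> set_fm F" for a
        proof -
          obtain k v where a: "a = (k, v)" by (cases a)
          have "k \<in> regular D" "v \<in> vals D k"
            using dynamic_over(1)[OF 2(2)] that a unfolding fm_over_def atoms_over_def by auto
          then show ?thesis using c t a unfolding base_laws_reduct by blast
        qed
        then show ?thesis using sat[OF R] unfolding 2(1) by (intro sat_reduct_head)
      qed
    qed
    then show ?thesis using sm t unfolding stable_model_iff by blast
  qed
  ultimately show ?thesis using s' unfolding states_iff stable_model_iff by blast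
qed

text \<open>The last slice is the result of a step, the earlier ones are found in the restriction.
  This makes the policy and the successor assumption applicable at every time.\<close>

lemma SM_states: "I \<in> SM (prog b m) \<Longrightarrow> i \<le> m \<Longrightarrow> part D (fl D) I i \<in> states D"
proof (induction m arbitrary: I)
  case 0
  have "part D (fl D) I 0 \<in> assigns D (fl D)" by (rule part_assigns[OF 0(1)]) auto
  then show ?case using SM_base[OF 0(1)] 0(2) states_iff by simp
next
  case (Suc m)
  show ?case
  proof (cases "i = Suc m")
    case True
    then show ?thesis using step_state[OF SM_step[OF Suc.prems(1)]] by simp
  next
    case False
    then have "i \<le> m" using Suc.prems(2) by simp
    moreover have "part D (fl D) (I \<inter> sig b m) i = part D (fl D) I i"
      by (rule part_Int_sig) (use \<open>i \<le> m\<close> in \<open>auto simp: consts_of_iff\<close>)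
    ultimately show ?thesis using Suc.IH[OF SM_restrict[OF Suc.prems(1)]] by simp
  qed
qed

lemma SM_actions: "I \<in> SM (prog b m) \<Longrightarrow> i < m \<Longrightarrow> part D (act D) I i \<in> assigns D (act D)"
  by (rule part_assigns) (auto simp: consts_of_iff)

text \<open>Without \<open>D_init\<close> the program for 0 steps has fluents as its only constants,
  so the state is the entire stable model.\<close>

lemma SM_state_unique:
  assumes "s \<in> states D"
  shows "I \<in> SM (prog False 0) \<and> part D (fl D) I 0 = s \<longleftrightarrow> I = stamp 0 s"
proof
  assume I: "I \<in> SM (prog False 0) \<and> part D (fl D) I 0 = s"
  then have "I \<subseteq> sig False 0" using SM_prog_subset by blast
  moreover have "sig False 0 = stamp 0 (atoms_over D (fl D))"
    unfolding sig_def stamp_def atoms_over_def eqs_def by force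
  ultimately have "I = I \<inter> stamp 0 (atoms_over D (fl D))" by blast
  then show "I = stamp 0 s" using I unfolding Int_stamp by simp
next
  assume "I = stamp 0 s"
  then show "I \<in> SM (prog False 0) \<and> part D (fl D) I 0 = s"
    using assms base_SM[of s] part_stamp[of s "fl D" 0] assigns_subset[of s "fl D"]
    unfolding states_iff by simp
qed

lemma SM_transition:
  assumes "K \<in> SM (prog False (Suc 0))"
  shows "transition D (part D (fl D) K 0) (part D (act D) K 0) (part D (fl D) K (Suc 0))"
proof -
  have "K \<inter> (stamp 0 (atoms_over D (fl D)) \<union> stamp 0 (atoms_over D (act D)) \<union> stamp 1 (atoms_over D (fl D)))
     = stamp 0 (part D (fl D) K 0) \<union> stamp 0 (part D (act D) K 0) \<union> stamp 1 (part D (fl D) K (Suc 0))"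
    unfolding Int_Un_distrib Int_stamp by simp
  then show ?thesis
    using assms unfolding transition_def residual_stable_model_def D_m_eq by (auto simp: part_def)
qed

text \<open>Connects the standing assumption with \<open>step\<close>. Towards \<open>step\<close>
  the utility atoms \<open>X\<close> may be arbitrary, since slices ignore them; in the other
  direction \<open>rewards\<close> provides them.\<close>

lemma step_iff_pf_transition:
  assumes s: "s \<in> states D"
  shows "pf_transition D s e s' f \<longleftrightarrow> step s e f s'"
proof
  assume t: "pf_transition D s e s' f"
  then obtain X where X: "X \<subseteq> {Utility u t | u t. True}"
    "stamp 0 s \<union> stamp 0 e \<union> stamp 1 s' \<union> stamp 0 f \<union> X \<in> SM (prog False (Suc 0))"
    unfolding pf_transition_def D_m_eq by auto
  let ?K = "stamp 0 s \<union> stamp 0 e \<union> stamp 1 s' \<union> stamp 0 f \<union> X"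
  have sub: "s \<subseteq> atoms_over D (fl D)" "e \<subseteq> atoms_over D (act D)" "s' \<subseteq> atoms_over D (fl D)"
    "f \<subseteq> atoms_over D (pf D)"
    using t assigns_subset unfolding pf_transition_def transition_def by blast+
  have K: "Eq (i, c) v \<in> ?K \<longleftrightarrow> i = 0 \<and> (c, v) \<in> s \<union> e \<union> f \<or> i = 1 \<and> (c, v) \<in> s'" for i c v
    using X(1) by (auto simp: in_stamp)
  have sort: "(c, v) \<in> s \<Longrightarrow> c \<in> fl D \<and> v \<in> vals D c" "(c, v) \<in> e \<Longrightarrow> c \<in> act D \<and> v \<in> vals D c"
    "(c, v) \<in> s' \<Longrightarrow> c \<in> fl D \<and> v \<in> vals D c" "(c, v) \<in> f \<Longrightarrow> c \<in> pf D \<and> v \<in> vals D c" for c v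
    using sub unfolding atoms_over_def by auto
  have ds: "\<not> (c \<in> fl D \<and> c \<in> act D)" "\<not> (c \<in> fl D \<and> c \<in> pf D)" "\<not> (c \<in> act D \<and> c \<in> pf D)" for c
    using disjoint_sorts by blast+
  have "(c, v) \<in> part D (fl D) ?K 0 \<longleftrightarrow> (c, v) \<in> s" "(c, v) \<in> part D (act D) ?K 0 \<longleftrightarrow> (c, v) \<in> e"
    "(c, v) \<in> part D (pf D) ?K 0 \<longleftrightarrow> (c, v) \<in> f" "(c, v) \<in> part D (fl D) ?K (Suc 0) \<longleftrightarrow> (c, v) \<in> s'" for c v
    using sort[of c v] ds[of c] unfolding in_part K by auto
  then have "part D (fl D) ?K 0 = s" "part D (act D) ?K 0 = e" "part D (pf D) ?K 0 = f"
    "part D (fl D) ?K (Suc 0) = s'" by auto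
  then show "step s e f s'" using SM_step[OF X(2)] by simp
next
  assume st: "step s e f s'"
  let ?I = "stamp 0 s" and ?K = "extend 0 (stamp 0 s) e f s'"
  have I: "?I \<in> SM (prog False 0)" "part D (fl D) ?I 0 = s" using SM_state_unique[OF s] by blast+
  have K: "?K \<in> SM (prog False (Suc 0))" using SM_extend[OF I(1)] st I(2) by simp
  have as: "e \<in> assigns D (act D)" "f \<in> assigns D (pf D)" "s' \<in> assigns D (fl D)"
    using st unfolding step_def by auto
  note P = extend_parts[OF SM_prog_subset[OF I(1)] assigns_subset[OF as(1)] assigns_subset[OF as(2)]
    assigns_subset[OF as(3)]]
  have "transition D s e s'"
    using SM_transition[OF K] P(3)[OF order_refl] P(4) P(6) I(2) by simp
  moreover have "?K = stamp 0 s \<union> stamp 0 e \<union> stamp 1 s' \<union> stamp 0 f \<union> rewards 0 s e s'"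
    unfolding extend_def I(2) by (simp add: Un_ac)
  moreover have "rewards 0 s e s' \<subseteq> {Utility u t | u t. True}" unfolding rewards_def by blast
  ultimately show "pf_transition D s e s' f"
    using K as(2) unfolding pf_transition_def D_m_eq by auto
qed

text \<open>The second claim supplies the transition through which the first standing assumption
  bounds the number of true actions in \<open>a\<close>.\<close>

lemma action_transition:
  assumes "a \<in> actions D"
  shows "a \<in> assigns D (act D)" "\<exists>s s'. transition D s a s'"
proof -
  obtain K where K: "K \<in> SM (prog False (Suc 0))" "K \<inter> stamp 0 (atoms_over D (act D)) = stamp 0 a"
    using assms unfolding actions_def residual_stable_model_def D_m_eq by auto
  then have a: "part D (act D) K 0 = a" unfolding Int_stamp stamp_inject by blast
  show "a \<in> assigns D (act D)" using SM_actions[OF K(1), of 0] a by simp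
  show "\<exists>s s'. transition D s a s'" using SM_transition[OF K(1)] a by blast
qed

text \<open>The successor assumption in terms of \<open>step\<close>; that the successor is a state
  is built in by \<open>step_state\<close>.\<close>

lemma step_ex1:
  assumes "standing_assumptions D" "s \<in> states D" "a \<in> actions D" "f \<in> assigns D (pf D)"
  shows "\<exists>!s'. step s a f s'"
proof -
  note am = conjunct1[OF assms(1)[unfolded standing_assumptions_def]]
    and un = conjunct1[OF conjunct2[OF assms(1)[unfolded standing_assumptions_def]]]
  have "at_most_one_action a" using am action_transition(2)[OF assms(3)] by blast
  then have "\<exists>!s'. s' \<in> states D \<and> pf_transition D s a s' f"
    using bspec[OF bspec[OF bspec[OF un assms(2)] action_transition(1)[OF assms(3)]] assms(4)] by simp
  moreover have "s' \<in> states D \<and> pf_transition D s a s' f \<longleftrightarrow> step s a f s'" for s'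
    using step_state step_iff_pf_transition[OF assms(2)] by blast
  ultimately show ?thesis by simp
qed

section \<open>Weights and utilities\<close>

lemma finite_rules: "finite (rules b m)"
proof -
  have fin: "finite (static_laws D)" "finite (dynamic_laws D)" "finite (initial_laws D)"
      "finite (utility_laws D)" "finite (regular D)" and v: "c \<in> regular D \<Longrightarrow> finite (vals D c)" for c
    using desc finite_vals[of c] unfolding action_description_def fl_def by auto
  have "static_rules i = (\<lambda>(F, G). rule (stamp_fm i F) (stamp_fm i G)) ` static_laws D" for i
    unfolding static_rules_def by force
  then have s: "finite (static_rules i)" for i using fin by simp
  have "dynamic_rules i = (\<lambda>(F, G, H). rule (stamp_fm (Suc i) F) (And (stamp_fm (Suc i) G) (stamp_fm i H)))
      ` dynamic_laws D" for i
    unfolding dynamic_rules_def by force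
  then have d: "finite (dynamic_rules i)" for i using fin by simp
  have "action_rules i = (\<lambda>(c, x). choice (Eq (i, c) (BVal x))) ` (act D \<times> UNIV)" for i
    unfolding action_rules_def by force
  then have a: "finite (action_rules i)" for i using finite_sorts by simp
  have "utility_rules i = (\<lambda>(v, F, G). rule (Atom (Utility v [Suc i, uid D (v, F, G)]))
     (And (stamp_fm (Suc i) F) (stamp_fm i G))) ` utility_laws D" for i
    unfolding utility_rules_def by force
  then have u: "finite (utility_rules i)" for i using fin by simp
  have "initial_choices = (\<lambda>(c, v). choice (Eq (0, c) v)) ` Sigma (regular D) (vals D)"
    unfolding initial_choices_def by force
  then have c: "finite initial_choices" using fin v by simp
  have "initial_constraints = (\<lambda>(A, G). rule Bot (And (Neg (Atom (stamp_atom 0 A))) (stamp_fm 0 G)))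
      ` initial_laws D"
    unfolding initial_constraints_def by force
  then have i: "finite initial_constraints" using fin by simp
  show ?thesis by (induction m) (auto simp: layer_rules_def s d a u c i)
qed

lemma finite_consts_of: "finite (consts_of b m)"
  by (induction m) (auto simp: layer_consts_def finite_sorts)

lemma finite_SM_prog: "finite (SM (prog b m))"
proof (rule finite_SM)
  show "finite (prog b m)" unfolding prog_def
    by (rule finite_mvpp[OF finite_consts_of _ pconsts_of_subset finite_rules])
      (rule consts_of_finite_vals)
qed

text \<open>These pairs correspond one to one to the soft rules satisfied by
  \<open>I\<close>.\<close>

definition pchoices :: "bool \<Rightarrow> nat \<Rightarrow> ('c, 'v) tatm set \<Rightarrow> ((nat \<times> 'c) \<times> 'v val) set" where
  "pchoices b m I = {(k, v). k \<in> pconsts_of b m \<and> v \<in> vals D (snd k) \<and> Eq k v \<in> I}"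

definition pweight :: "('c, 'v) assign \<Rightarrow> real" where
  "pweight f = (\<Prod>(c, v)\<in>f. decl D c v)"

lemma finite_pchoices: "finite (pchoices b m I)"
proof (rule finite_subset)
  show "pchoices b m I \<subseteq> Sigma (consts_of b m) (\<lambda>k. vals D (snd k))"
    using pconsts_of_subset[of b m] unfolding pchoices_def by auto
  show "finite (Sigma (consts_of b m) (\<lambda>k. vals D (snd k)))"
    using finite_consts_of consts_of_finite_vals by (intro finite_SigmaI)
qed

lemma pconsts_of_sort: "(i, c) \<in> pconsts_of b m \<Longrightarrow> c \<in> pf D \<union> initpf D"
  by (cases b) (auto simp: pconsts_of_False pconsts_of_True)

lemma decl_pos: "c \<in> pf D \<union> initpf D \<Longrightarrow> v \<in> vals D c \<Longrightarrow> 0 < decl D c v"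
  using desc unfolding action_description_def by blast

text \<open>The exponential of a sum of logarithms is the product of the declared probabilities,
  because these are positive.\<close>

lemma weight_of_prog:
  assumes I: "I \<in> SM (prog b m)"
  shows "weight_of (prog b m) I = (\<Prod>(k, v)\<in>pchoices b m I. decl D (snd k) v)"
proof -
  let ?g = "\<lambda>(k, v). (ln (decl D (snd k) v), Atom (Eq k v))"
  have S: "{(w, R). (Soft w, R) \<in> sat_part (prog b m) I} = ?g ` pchoices b m I"
  proof -
    have "(Soft w, R) \<in> sat_part (prog b m) I \<longleftrightarrow> (w, R) \<in> ?g ` pchoices b m I" for w R
      unfolding sat_part_def prog_def pchoices_def by (auto simp: soft_in_mvpp image_iff)
    then show ?thesis by auto
  qed
  \<comment> \<open>The atom determines the pair, so choices with equal weights remain separate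
    summands.\<close>
  have "inj_on ?g (pchoices b m I)" by (auto simp: inj_on_def)
  then have "(\<Sum>(w, R)\<in>?g ` pchoices b m I. w) = (\<Sum>(k, v)\<in>pchoices b m I. ln (decl D (snd k) v))"
    by (subst sum.reindex) (auto simp: case_prod_beta intro!: sum.cong)
  then have "weight_of (prog b m) I = exp (\<Sum>(k, v)\<in>pchoices b m I. ln (decl D (snd k) v))"
    unfolding weight_of_def S using I by simp
  also have "\<dots> = (\<Prod>x\<in>pchoices b m I. exp (case x of (k, v) \<Rightarrow> ln (decl D (snd k) v)))"
    by (rule exp_sum[OF finite_pchoices])
  also have "\<dots> = (\<Prod>(k, v)\<in>pchoices b m I. decl D (snd k) v)"
  proof (rule prod.cong[OF refl])
    fix x assume x: "x \<in> pchoices b m I"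
    obtain i c v where x': "x = ((i, c), v)" by (metis surj_pair)
    have "0 < decl D c v" using x pconsts_of_sort[of i c b m] decl_pos unfolding x' pchoices_def by auto
    then show "exp (case x of (k, v) \<Rightarrow> ln (decl D (snd k) v)) = (case x of (k, v) \<Rightarrow> decl D (snd k) v)"
      unfolding x' by simp
  qed
  finally show ?thesis .
qed

lemma weight_pos: "I \<in> SM \<Pi> \<Longrightarrow> 0 < weight_of \<Pi> I"
  unfolding weight_of_def by simp

lemma finite_assigns:
  assumes "finite C" "\<And>c. c \<in> C \<Longrightarrow> finite (vals D c)"
  shows "finite (assigns D C)" and "f \<in> assigns D C \<Longrightarrow> finite f"
proof -
  have "atoms_over D C = Sigma C (vals D)" unfolding atoms_over_def by auto
  then have f: "finite (atoms_over D C)" using assms by simp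
  show "finite (assigns D C)"
    by (rule finite_subset[of _ "Pow (atoms_over D C)"]) (use assigns_subset f in auto)
  show "f \<in> assigns D C \<Longrightarrow> finite f"
    using finite_subset[OF assigns_subset f] by blast
qed

lemma finite_pf_assigns: "finite (assigns D (pf D))" "f \<in> assigns D (pf D) \<Longrightarrow> finite f"
  using finite_assigns[of "pf D"] finite_sorts finite_vals by auto

lemma finite_states: "finite (states D)"
  by (rule finite_subset[OF _ finite_assigns(1)[of "fl D"]])
    (use state_assigns finite_sorts finite_vals in auto)

lemma pweight_pos: "f \<in> assigns D (pf D) \<Longrightarrow> 0 < pweight f"
  unfolding pweight_def
proof (rule prod_pos)
  fix x assume "f \<in> assigns D (pf D)" "x \<in> f"
  then have "x \<in> atoms_over D (pf D)" using assigns_subset by blast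
  then show "0 < (case x of (c, v) \<Rightarrow> decl D c v)"
    using decl_pos unfolding atoms_over_def by auto
qed

text \<open>A sum over an empty domain would be 0, but declared probabilities add up to 1.\<close>

lemma pf_assigns_nonempty: "assigns D (pf D) \<noteq> {}"
proof -
  have "vals D c \<noteq> {}" if "c \<in> pf D" for c
  proof -
    have "(\<Sum>v\<in>vals D c. decl D c v) = 1" using desc that unfolding action_description_def by blast
    then show ?thesis by auto
  qed
  then have "\<forall>c\<in>pf D. \<exists>v. v \<in> vals D c" by blast
  then obtain g where g: "\<forall>c\<in>pf D. g c \<in> vals D c" by (auto dest: bchoice)
  then have "(\<lambda>c. (c, g c)) ` pf D \<in> assigns D (pf D)"
    unfolding assigns_def atoms_over_def by auto
  then show ?thesis by blast
qed

text \<open>The factor that a step contributes under a policy. By distributivity it is the product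
  of the declared sums, hence 1; it is carried as a symbol that enters both probabilities in the
  same way.\<close>

definition total_pweight :: real where
  "total_pweight = (\<Sum>f\<in>assigns D (pf D). pweight f)"

lemma total_pweight_pos: "0 < total_pweight"
  unfolding total_pweight_def
  by (rule sum_pos[OF finite_pf_assigns(1) pf_assigns_nonempty pweight_pos])

lemma weight_extend:
  assumes I: "I \<in> SM (prog b m)" and st: "step (part D (fl D) I m) e f s'"
  shows "weight_of (prog b (Suc m)) (extend m I e f s') = weight_of (prog b m) I * pweight f"
proof -
  let ?K = "extend m I e f s'" and ?h = "\<lambda>(c, v). ((m, c), v)"
  have as: "e \<in> assigns D (act D)" "f \<in> assigns D (pf D)" "s' \<in> assigns D (fl D)"
    using st unfolding step_def by auto
  note P = extend_parts[OF SM_prog_subset[OF I] assigns_subset[OF as(1)] assigns_subset[OF as(2)]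
    assigns_subset[OF as(3)]]
  have old: "Eq k v \<in> ?K \<longleftrightarrow> Eq k v \<in> I" if "k \<in> pconsts_of b m" "v \<in> vals D (snd k)" for k v
  proof -
    have "Eq k v \<in> sig b m"
      using that pconsts_of_subset[of b m] by (cases k) (auto simp: eq_in_sig)
    then show ?thesis using P(1) by blast
  qed
  have new: "c \<in> pf D \<and> v \<in> vals D c \<and> Eq (m, c) v \<in> ?K \<longleftrightarrow> (c, v) \<in> f" for c v
    using P(7) in_part[of c v D "pf D" ?K m] by blast
  have "x \<in> pchoices b (Suc m) ?K \<longleftrightarrow> x \<in> pchoices b m I \<union> ?h ` f" for x
  proof -
    obtain k v where x: "x = (k, v)" by (cases x)
    have "x \<in> pchoices b (Suc m) ?K \<longleftrightarrow>
        (k \<in> pconsts_of b m \<and> v \<in> vals D (snd k) \<and> Eq k v \<in> I) \<or>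
        (k \<in> {m} \<times> pf D \<and> v \<in> vals D (snd k) \<and> Eq k v \<in> ?K)"
      unfolding x pchoices_def using old[of k v] by auto
    also have "(k \<in> {m} \<times> pf D \<and> v \<in> vals D (snd k) \<and> Eq k v \<in> ?K) \<longleftrightarrow> x \<in> ?h ` f"
      unfolding x using new[of "snd k" v] by (cases k) (force simp: image_iff)
    finally show ?thesis unfolding x pchoices_def by auto
  qed
  then have split: "pchoices b (Suc m) ?K = pchoices b m I \<union> ?h ` f" by blast
  \<comment> \<open>Older pf constants have stamps below \<open>m\<close>. For \<open>m = 0\<close>
    an initpf constant could have the same stamp, and disjointness of the sorts excludes
    this.\<close>
  have "((i, c), v) \<notin> pchoices b m I" if "(c, v) \<in> f" "i = m" for i c v
  proof -
    have "c \<in> pf D" using that new by blast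
    then have "(m, c) \<notin> pconsts_of b m"
      using disjoint_sorts by (cases b) (auto simp: pconsts_of_False pconsts_of_True)
    then show ?thesis using that(2) unfolding pchoices_def by auto
  qed
  then have disj: "pchoices b m I \<inter> ?h ` f = {}" by auto
  have "(\<Prod>(k, v)\<in>?h ` f. decl D (snd k) v) = pweight f"
    unfolding pweight_def by (subst prod.reindex) (auto simp: inj_on_def intro!: prod.cong)
  then show ?thesis
    unfolding weight_of_prog[OF SM_extend[OF I st]] weight_of_prog[OF I] split
    by (subst prod.union_disjoint[OF finite_pchoices _ disj]) (use finite_pf_assigns(2)[OF as(2)] in auto)
qed

lemma weight_stamp: "s \<in> states D \<Longrightarrow> weight_of (prog False 0) (stamp 0 s) = 1"
  using weight_of_prog[of "stamp 0 s" False 0] SM_state_unique[of s "stamp 0 s"]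
  by (simp add: pchoices_def)

definition step_reward :: "('c, 'v) assign \<Rightarrow> ('c, 'v) assign \<Rightarrow> ('c, 'v) assign \<Rightarrow> real" where
  "step_reward s e s' = (\<Sum>(v, F, G) | (v, F, G) \<in> utility_laws D \<and> sat s' F \<and> sat (s \<union> e) G. v)"

lemma finite_uatoms: "finite (uatoms i)"
proof -
  have "uatoms i = (\<lambda>(v, F, G). Utility v [Suc i, uid D (v, F, G)]) ` utility_laws D"
    unfolding uatoms_def by force
  then show ?thesis using desc unfolding action_description_def by simp
qed

lemma finite_utilities:
  assumes "I \<subseteq> sig b m" shows "finite {(u, t). Utility u t \<in> I}"
proof -
  have "(\<lambda>(u, t). Utility u t) ` {(u, t). Utility u t \<in> I} \<subseteq> (\<Union>i<m. uatoms i)"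
    using assms unfolding sig_def by (auto simp: in_eqs)
  moreover have "finite (\<Union>i<m. uatoms i)" using finite_uatoms by simp
  ultimately have "finite ((\<lambda>(u, t). Utility u t) ` {(u, t). Utility u t \<in> I} :: ('c, 'v) tatm set)"
    by (rule finite_subset)
  then show ?thesis by (rule finite_imageD) (auto simp: inj_on_def)
qed

lemma utility_extend:
  assumes I: "I \<in> SM (prog b m)" and st: "step (part D (fl D) I m) e f s'"
  shows "utility (extend m I e f s') = utility I + step_reward (part D (fl D) I m) e s'"
proof -
  let ?K = "extend m I e f s'" and ?s = "part D (fl D) I m"
  let ?L = "{(v, F, G). (v, F, G) \<in> utility_laws D \<and> sat s' F \<and> sat (?s \<union> e) G}"
  let ?h = "\<lambda>(v, F, G). (v, [Suc m, uid D (v, F, G)])"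
  have sub: "I \<subseteq> sig b m" by (rule SM_prog_subset[OF I])
  have "(u, t) \<in> {(u, t). Utility u t \<in> rewards m ?s e s'} \<longleftrightarrow> (u, t) \<in> ?h ` ?L" for u t
    unfolding rewards_def by (auto simp: image_iff)
  then have R: "{(u, t). Utility u t \<in> rewards m ?s e s'} = ?h ` ?L" by auto
  have split: "{(u, t). Utility u t \<in> ?K} = {(u, t). Utility u t \<in> I} \<union> ?h ` ?L"
    unfolding R[symmetric] extend_def by auto
  have "I \<inter> uatoms m = {}" using sub sig_layer_disjoint[of b m] unfolding layer_def by blast
  then have disj: "{(u, t). Utility u t \<in> I} \<inter> ?h ` ?L = {}"
    using rewards_uatoms[of m ?s e s'] unfolding R[symmetric] by blast
  have fin: "finite ?L"
    by (rule finite_subset[of _ "utility_laws D"]) (use desc in \<open>auto simp: action_description_def\<close>)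
  \<comment> \<open>The identifiers keep laws with the same reward from collapsing into one utility
    atom.\<close>
  have "inj_on ?h ?L" using uid_inj by (auto simp: inj_on_def)
  then have "(\<Sum>(u, t)\<in>?h ` ?L. u) = step_reward ?s e s'"
    unfolding step_reward_def by (subst sum.reindex) (auto intro!: sum.cong)
  then show ?thesis
    unfolding utility_def split
    by (subst sum.union_disjoint[OF finite_utilities[OF sub] _ disj]) (use fin in auto)
qed

lemma utility_base: "I \<in> SM (prog b 0) \<Longrightarrow> utility I = 0"
proof -
  assume "I \<in> SM (prog b 0)"
  then have "I \<subseteq> sig b 0" by (rule SM_prog_subset)
  then have "{(u, t). Utility u t \<in> I} = {}" unfolding sig_def by (auto simp: in_eqs)
  then show ?thesis unfolding utility_def by simp
qed

section \<open>Runs\<close>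

definition runs :: "bool \<Rightarrow> nat \<Rightarrow> (nat \<Rightarrow> ('c, 'v) assign) \<Rightarrow> (nat \<Rightarrow> ('c, 'v) assign) \<Rightarrow>
    ('c, 'v) tatm set set" where
  "runs b m s a = {I \<in> SM (prog b m). (\<forall>i\<le>m. part D (fl D) I i = s i) \<and>
     (\<forall>i<m. part D (act D) I i = a i)}"

text \<open>Intended as the stable models of the conditioning formula: later states are left free
  and only the initial one is fixed.\<close>

definition policy_runs :: "bool \<Rightarrow> nat \<Rightarrow> ('c, 'v) assign \<Rightarrow>
    (('c, 'v) assign \<Rightarrow> nat \<Rightarrow> ('c, 'v) assign) \<Rightarrow> ('c, 'v) tatm set set" where
  "policy_runs b m s0 \<pi> = {I \<in> SM (prog b m). part D (fl D) I 0 = s0 \<and>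
     (\<forall>i<m. part D (act D) I i = \<pi> (part D (fl D) I i) i)}"

lemma runs_SM: "I \<in> runs b m s a \<Longrightarrow> I \<in> SM (prog b m)"
  unfolding runs_def by blast

lemma policy_runs_SM: "I \<in> policy_runs b m s0 \<pi> \<Longrightarrow> I \<in> SM (prog b m)"
  unfolding policy_runs_def by blast

definition total_weight :: "bool \<Rightarrow> nat \<Rightarrow> ('c, 'v) tatm set set \<Rightarrow> real" where
  "total_weight b m X = (\<Sum>I\<in>X. weight_of (prog b m) I)"

text \<open>An unnormalised transition probability: several pf assignments may lead to the same
  successor.\<close>

definition step_weight :: "('c, 'v) assign \<Rightarrow> ('c, 'v) assign \<Rightarrow> ('c, 'v) assign \<Rightarrow> real" where
  "step_weight s e s' = (\<Sum>f | step s e f s'. pweight f)"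

lemma SM_extend_parts:
  assumes I: "I \<in> SM (prog b m)" and st: "step (part D (fl D) I m) e f s'"
  shows "extend m I e f s' \<inter> sig b m = I"
    "i \<le> m \<Longrightarrow> part D (fl D) (extend m I e f s') i = part D (fl D) I i"
    "part D (fl D) (extend m I e f s') (Suc m) = s'"
    "i < m \<Longrightarrow> part D (act D) (extend m I e f s') i = part D (act D) I i"
    "part D (act D) (extend m I e f s') m = e"
    "part D (pf D) (extend m I e f s') m = f"
proof -
  have as: "e \<in> assigns D (act D)" "f \<in> assigns D (pf D)" "s' \<in> assigns D (fl D)"
    using st unfolding step_def by auto
  note P = extend_parts[OF SM_prog_subset[OF I] assigns_subset[OF as(1)] assigns_subset[OF as(2)]
    assigns_subset[OF as(3)]]
  show "extend m I e f s' \<inter> sig b m = I"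
    "i \<le> m \<Longrightarrow> part D (fl D) (extend m I e f s') i = part D (fl D) I i"
    "part D (fl D) (extend m I e f s') (Suc m) = s'"
    "i < m \<Longrightarrow> part D (act D) (extend m I e f s') i = part D (act D) I i"
    "part D (act D) (extend m I e f s') m = e"
    "part D (pf D) (extend m I e f s') m = f"
    by (rule P(1) P(3) P(4) P(5) P(6) P(7); assumption)+
qed

lemma SM_restrict_parts:
  "i \<le> m \<Longrightarrow> part D (fl D) (K \<inter> sig b m) i = part D (fl D) K i"
  "i < m \<Longrightarrow> part D (act D) (K \<inter> sig b m) i = part D (act D) K i"
  by (rule part_Int_sig; auto simp: consts_of_iff)+

text \<open>Along a fixed history the pf assignment is the only free datum of a step; it ranges over
  those that realise the step.\<close>

lemma runs_Suc:
  "bij_betw (\<lambda>(I, f). extend m I (a m) f (s (Suc m)))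
     (runs b m s a \<times> {f. step (s m) (a m) f (s (Suc m))}) (runs b (Suc m) s a)"
  unfolding bij_betw_def
proof
  let ?h = "\<lambda>(I, f). extend m I (a m) f (s (Suc m))"
    and ?A = "runs b m s a \<times> {f. step (s m) (a m) f (s (Suc m))}"
  have P: "I \<in> SM (prog b m)" "part D (fl D) I m = s m" "step (part D (fl D) I m) (a m) f (s (Suc m))"
    if "(I, f) \<in> ?A" for I f using that unfolding runs_def by auto
  show "inj_on ?h ?A"
  proof (rule inj_onI)
    fix x y assume x: "x \<in> ?A" and y: "y \<in> ?A" and e: "?h x = ?h y"
    obtain I f where x': "x = (I, f)" by (cases x)
    obtain J g where y': "y = (J, g)" by (cases y)
    have "I = J" using SM_extend_parts(1)[OF P(1,3)[OF x[unfolded x']]]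
        SM_extend_parts(1)[OF P(1,3)[OF y[unfolded y']]] e unfolding x' y' by simp
    moreover have "f = g" using SM_extend_parts(6)[OF P(1,3)[OF x[unfolded x']]]
        SM_extend_parts(6)[OF P(1,3)[OF y[unfolded y']]] e unfolding x' y' by simp
    ultimately show "x = y" unfolding x' y' by simp
  qed
  show "?h ` ?A = runs b (Suc m) s a"
  proof (intro equalityI subsetI)
    fix K assume "K \<in> ?h ` ?A"
    then obtain I f where If: "(I, f) \<in> ?A" and K: "K = extend m I (a m) f (s (Suc m))" by auto
    note Q = SM_extend_parts[OF P(1,3)[OF If], folded K]
    have "K \<in> SM (prog b (Suc m))" using SM_extend[OF P(1,3)[OF If]] K by simp
    moreover have "part D (fl D) K i = s i" if "i \<le> Suc m" for i
      using Q(2,3) that If unfolding runs_def by (cases "i = Suc m") auto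
    moreover have "part D (act D) K i = a i" if "i < Suc m" for i
      using Q(4,5) that If unfolding runs_def by (cases "i = m") auto
    ultimately show "K \<in> runs b (Suc m) s a" unfolding runs_def by blast
  next
    fix K assume "K \<in> runs b (Suc m) s a"
    then have K: "K \<in> SM (prog b (Suc m))" and s: "\<And>i. i \<le> Suc m \<Longrightarrow> part D (fl D) K i = s i"
      and a: "\<And>i. i < Suc m \<Longrightarrow> part D (act D) K i = a i"
      unfolding runs_def by auto
    have "K \<inter> sig b m \<in> runs b m s a"
      using SM_restrict[OF K] SM_restrict_parts s a unfolding runs_def by simp
    moreover have "step (s m) (a m) (part D (pf D) K m) (s (Suc m))"
      using SM_step[OF K] s a by simp
    moreover have "K = extend m (K \<inter> sig b m) (a m) (part D (pf D) K m) (s (Suc m))"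
      using SM_extend_eq[OF K] s a by simp
    ultimately show "K \<in> ?h ` ?A" by (intro image_eqI[of _ _ "(K \<inter> sig b m, part D (pf D) K m)"]) auto
  qed
qed

lemma total_weight_runs_Suc:
  "total_weight b (Suc m) (runs b (Suc m) s a) =
     total_weight b m (runs b m s a) * step_weight (s m) (a m) (s (Suc m))"
proof -
  let ?h = "\<lambda>(I, f). extend m I (a m) f (s (Suc m))"
    and ?A = "runs b m s a \<times> {f. step (s m) (a m) f (s (Suc m))}"
  have "total_weight b (Suc m) (runs b (Suc m) s a) = (\<Sum>x\<in>?A. weight_of (prog b (Suc m)) (?h x))"
    unfolding total_weight_def by (rule sum.reindex_bij_betw[OF runs_Suc, symmetric])
  also have "\<dots> = (\<Sum>(I, f)\<in>?A. weight_of (prog b m) I * pweight f)"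
    by (intro sum.cong refl) (auto simp: runs_def weight_extend)
  also have "\<dots> = total_weight b m (runs b m s a) * step_weight (s m) (a m) (s (Suc m))"
    unfolding total_weight_def step_weight_def sum_product sum.cartesian_product ..
  finally show ?thesis .
qed

lemma total_weight_runs:
  "total_weight b m (runs b m s a) =
     total_weight b 0 (runs b 0 s a) * (\<Prod>i<m. step_weight (s i) (a i) (s (Suc i)))"
  by (induction m) (simp_all add: total_weight_runs_Suc)

lemma utility_runs:
  "I \<in> runs b m s a \<Longrightarrow> utility I = (\<Sum>i<m. step_reward (s i) (a i) (s (Suc i)))"
proof (induction m arbitrary: I)
  case 0
  then show ?case using utility_base[of I b] unfolding runs_def by simp
next
  case (Suc m)
  then have "I \<in> (\<lambda>(I, f). extend m I (a m) f (s (Suc m))) `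
      (runs b m s a \<times> {f. step (s m) (a m) f (s (Suc m))})"
    using bij_betw_imp_surj_on[OF runs_Suc[of m a s b]] by simp
  then obtain J f where J: "J \<in> runs b m s a" "step (s m) (a m) f (s (Suc m))"
    "I = extend m J (a m) f (s (Suc m))" by auto
  then have "J \<in> SM (prog b m)" "part D (fl D) J m = s m" unfolding runs_def by auto
  then show ?case using utility_extend[of J b m "a m" f "s (Suc m)"] Suc.IH[OF J(1)] J(2,3) by simp
qed

text \<open>Here the successor is free but determined by the pf assignment, which ranges over all
  assignments.\<close>

lemma policy_runs_Suc:
  assumes sa: "standing_assumptions D" and \<pi>: "\<forall>t\<in>states D. \<pi> t m \<in> actions D"
  shows "bij_betw (\<lambda>(I, f). extend m I (\<pi> (part D (fl D) I m) m) f
      (THE s'. step (part D (fl D) I m) (\<pi> (part D (fl D) I m) m) f s'))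
     (policy_runs b m s0 \<pi> \<times> assigns D (pf D)) (policy_runs b (Suc m) s0 \<pi>)"
  unfolding bij_betw_def
proof
  let ?e = "\<lambda>I. \<pi> (part D (fl D) I m) m"
  let ?n = "\<lambda>I f. THE s'. step (part D (fl D) I m) (?e I) f s'"
  let ?h = "\<lambda>(I, f). extend m I (?e I) f (?n I f)" and ?A = "policy_runs b m s0 \<pi> \<times> assigns D (pf D)"
  have ex1: "\<exists>!s'. step (part D (fl D) I m) (?e I) f s'" if "I \<in> SM (prog b m)" "f \<in> assigns D (pf D)" for I f
    using step_ex1[OF sa _ _ that(2)] SM_states[OF that(1) order_refl] \<pi> by blast
  have P: "I \<in> SM (prog b m)" "step (part D (fl D) I m) (?e I) f (?n I f)" if "(I, f) \<in> ?A" for I f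
  proof -
    show I: "I \<in> SM (prog b m)" using that unfolding policy_runs_def by auto
    show "step (part D (fl D) I m) (?e I) f (?n I f)"
      by (rule theI'[OF ex1[OF I]]) (use that in auto)
  qed
  show "inj_on ?h ?A"
  proof (rule inj_onI)
    fix x y assume x: "x \<in> ?A" and y: "y \<in> ?A" and e: "?h x = ?h y"
    obtain I f where x': "x = (I, f)" by (cases x)
    obtain J g where y': "y = (J, g)" by (cases y)
    have e': "extend m I (?e I) f (?n I f) = extend m J (?e J) g (?n J g)"
      using e unfolding x' y' by simp
    have "I = J" using SM_extend_parts(1)[OF P[OF x[unfolded x']]]
        SM_extend_parts(1)[OF P[OF y[unfolded y']]] unfolding e' by simp
    moreover have "f = g" using SM_extend_parts(6)[OF P[OF x[unfolded x']]]
        SM_extend_parts(6)[OF P[OF y[unfolded y']]] unfolding e' by simp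
    ultimately show "x = y" unfolding x' y' by simp
  qed
  show "?h ` ?A = policy_runs b (Suc m) s0 \<pi>"
  proof (intro equalityI subsetI)
    fix K assume "K \<in> ?h ` ?A"
    then obtain I f where If: "(I, f) \<in> ?A" and K: "K = extend m I (?e I) f (?n I f)" by auto
    note Q = SM_extend_parts[OF P[OF If], folded K]
    have "K \<in> SM (prog b (Suc m))" using SM_extend[OF P[OF If]] K by simp
    moreover have "part D (fl D) K 0 = s0" using Q(2)[of 0] If unfolding policy_runs_def by simp
    moreover have "part D (act D) K i = \<pi> (part D (fl D) K i) i" if "i < Suc m" for i
      using Q(2,4,5) that If unfolding policy_runs_def by (cases "i = m") auto
    ultimately show "K \<in> policy_runs b (Suc m) s0 \<pi>" unfolding policy_runs_def by blast
  next
    fix K assume "K \<in> policy_runs b (Suc m) s0 \<pi>"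
    then have K: "K \<in> SM (prog b (Suc m))" and s: "part D (fl D) K 0 = s0"
      and a: "\<And>i. i < Suc m \<Longrightarrow> part D (act D) K i = \<pi> (part D (fl D) K i) i"
      unfolding policy_runs_def by auto
    let ?I = "K \<inter> sig b m" and ?f = "part D (pf D) K m"
    have I: "?I \<in> SM (prog b m)" by (rule SM_restrict[OF K])
    have fm: "part D (fl D) ?I m = part D (fl D) K m" using SM_restrict_parts(1) by simp
    have st: "step (part D (fl D) ?I m) (?e ?I) ?f (part D (fl D) K (Suc m))"
      using SM_step[OF K] a[of m] unfolding fm by simp
    then have f: "?f \<in> assigns D (pf D)" unfolding step_def by blast
    \<comment> \<open>By uniqueness the successor chosen by \<open>THE\<close> is the one found in
      \<open>K\<close>.\<close>
    have n: "?n ?I ?f = part D (fl D) K (Suc m)"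
      using the1_equality[OF ex1[OF I f] st] .
    have "?I \<in> policy_runs b m s0 \<pi>"
      using I SM_restrict_parts[of _ m K b] s a unfolding policy_runs_def by simp
    moreover have "K = extend m ?I (?e ?I) ?f (?n ?I ?f)"
      using SM_extend_eq[OF K] a[of m] unfolding n unfolding fm by simp
    ultimately show "K \<in> ?h ` ?A" using f by (intro image_eqI[of _ _ "(?I, ?f)"]) auto
  qed
qed

text \<open>Each pf assignment gives exactly one extension, and the factor depends on it alone. So
  the sum factorises although the runs branch into different states.\<close>

lemma total_weight_policy_runs:
  assumes sa: "standing_assumptions D" and \<pi>: "\<forall>t\<in>states D. \<forall>i<m. \<pi> t i \<in> actions D"
  shows "total_weight b m (policy_runs b m s0 \<pi>) =
     total_weight b 0 (policy_runs b 0 s0 \<pi>) * total_pweight ^ m"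
  using \<pi>
proof (induction m)
  case (Suc m)
  let ?e = "\<lambda>I. \<pi> (part D (fl D) I m) m"
  let ?n = "\<lambda>I f. THE s'. step (part D (fl D) I m) (?e I) f s'"
  let ?h = "\<lambda>(I, f). extend m I (?e I) f (?n I f)" and ?A = "policy_runs b m s0 \<pi> \<times> assigns D (pf D)"
  have \<pi>m: "\<forall>t\<in>states D. \<pi> t m \<in> actions D" using Suc.prems by blast
  have "total_weight b (Suc m) (policy_runs b (Suc m) s0 \<pi>) = (\<Sum>x\<in>?A. weight_of (prog b (Suc m)) (?h x))"
    unfolding total_weight_def by (rule sum.reindex_bij_betw[OF policy_runs_Suc[where \<pi> = \<pi> and m = m, OF sa \<pi>m], symmetric])
  also have "\<dots> = (\<Sum>(I, f)\<in>?A. weight_of (prog b m) I * pweight f)"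
  proof (intro sum.cong refl)
    fix x assume x: "x \<in> ?A"
    obtain I f where x': "x = (I, f)" by (cases x)
    have I: "I \<in> SM (prog b m)" using x unfolding x' policy_runs_def by auto
    have f: "f \<in> assigns D (pf D)" using x unfolding x' by auto
    have "\<exists>!s'. step (part D (fl D) I m) (?e I) f s'"
      using step_ex1[OF sa _ _ f] SM_states[OF I order_refl] \<pi>m by blast
    then have "step (part D (fl D) I m) (?e I) f (?n I f)" by (rule theI')
    then show "weight_of (prog b (Suc m)) (?h x) = (case x of (I, f) \<Rightarrow> weight_of (prog b m) I * pweight f)"
      using weight_extend[OF I] unfolding x' by simp
  qed
  also have "\<dots> = total_weight b m (policy_runs b m s0 \<pi>) * total_pweight"
    unfolding total_weight_def total_pweight_def sum_product sum.cartesian_product ..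
  finally show ?case using Suc by simp
qed simp

text \<open>There is one such stable model, and its weight is an empty product.\<close>

lemma total_weight_base: "s \<in> states D \<Longrightarrow> total_weight False 0 {I \<in> SM (prog False 0). part D (fl D) I 0 = s} = 1"
  using SM_state_unique[of s] weight_stamp[of s] unfolding total_weight_def by simp

section \<open>Formulas about runs\<close>

text \<open>The conjunction by itself only puts \<open>t\<close> inside the slice; equality follows
  because both are total assignments.\<close>

lemma sat_at_time:
  assumes "finite C" "\<And>c. c \<in> C \<Longrightarrow> finite (vals D c)" "t \<in> assigns D C" "part D C I i \<in> assigns D C"
  shows "sat I (at_time i t) \<longleftrightarrow> part D C I i = t"
proof -
  have "finite t" using finite_assigns(2)[OF assms(1-3)] .
  then have "sat I (at_time i t) \<longleftrightarrow> stamp i t \<subseteq> I"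
    unfolding at_time_def stamp_def by (subst sat_Conj) auto
  also have "\<dots> \<longleftrightarrow> t \<subseteq> part D C I i"
    using assigns_subset[OF assms(3)] unfolding stamp_def part_def proj_def by auto
  also have "\<dots> \<longleftrightarrow> part D C I i = t"
    using assigns_subset_eq[OF assms(3,4)] by blast
  finally show ?thesis .
qed

lemma sat_at_time_state:
  assumes "I \<in> SM (prog b m)" "i \<le> m" "t \<in> states D"
  shows "sat I (at_time i t) \<longleftrightarrow> part D (fl D) I i = t"
  by (rule sat_at_time) (use finite_sorts finite_vals state_assigns assms SM_states in auto)

lemma sat_at_time_action:
  assumes "I \<in> SM (prog b m)" "i < m" "a \<in> actions D"
  shows "sat I (at_time i a) \<longleftrightarrow> part D (act D) I i = a"
  by (rule sat_at_time) (use finite_sorts finite_vals action_transition(1) assms SM_actions in auto)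

text \<open>The length \<open>n\<close> is independent of \<open>m\<close>, so that
  \<open>n = 0\<close> covers the condition on the initial state.\<close>

lemma sat_seq_fm:
  assumes "I \<in> SM (prog b m)" "n \<le> m" "\<forall>i\<le>n. s i \<in> states D"
  shows "sat I (seq_fm n s) \<longleftrightarrow> (\<forall>i\<le>n. part D (fl D) I i = s i)"
proof -
  have "sat I (seq_fm n s) \<longleftrightarrow> (\<forall>i\<le>n. sat I (at_time i (s i)))"
    unfolding seq_fm_def by (auto simp: less_Suc_eq_le)
  then show ?thesis using sat_at_time_state[OF assms(1)] assms(2,3) by auto
qed

lemma sat_policy_fm:
  assumes I: "I \<in> SM (prog b m)" and \<pi>: "\<forall>t\<in>states D. \<forall>i<m. \<pi> t i \<in> actions D"
  shows "sat I (policy_fm D \<pi> m) \<longleftrightarrow> (\<forall>i<m. part D (act D) I i = \<pi> (part D (fl D) I i) i)"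
proof -
  have "{Imp (at_time i s) (at_time i (\<pi> s i)) | s i. s \<in> states D \<and> i < m} =
      (\<lambda>(s, i). Imp (at_time i s) (at_time i (\<pi> s i))) ` (states D \<times> {..<m})" by auto
  then have "finite {Imp (at_time i s) (at_time i (\<pi> s i)) | s i. s \<in> states D \<and> i < m}"
    using finite_states by simp
  then have "sat I (policy_fm D \<pi> m) \<longleftrightarrow>
      (\<forall>s\<in>states D. \<forall>i<m. sat I (Imp (at_time i s) (at_time i (\<pi> s i))))"
    unfolding policy_fm_def by (subst sat_Conj) blast+
  also have "\<dots> \<longleftrightarrow> (\<forall>s\<in>states D. \<forall>i<m. sat I (at_time i s) \<longrightarrow> sat I (at_time i (\<pi> s i)))"
    by simp
  also have "\<dots> \<longleftrightarrow> (\<forall>s\<in>states D. \<forall>i<m. part D (fl D) I i = s \<longrightarrow> part D (act D) I i = \<pi> s i)"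
    using sat_at_time_state[OF I] sat_at_time_action[OF I] \<pi> by auto
  also have "\<dots> \<longleftrightarrow> (\<forall>i<m. part D (act D) I i = \<pi> (part D (fl D) I i) i)"
  proof -
    \<comment> \<open>Every slice is a state, so at each time exactly one implication of the policy
      formula has a true premise.\<close>
    have "\<forall>i<m. part D (fl D) I i \<in> states D" using SM_states[OF I] by simp
    then show ?thesis by blast
  qed
  finally show ?thesis .
qed

lemma sat_history_fm:
  assumes I: "I \<in> SM (prog b m)" and s: "\<forall>i\<le>m. s i \<in> states D" and a: "\<forall>i<m. a i \<in> actions D"
  shows "sat I (history_fm m (s, a)) \<longleftrightarrow> I \<in> runs b m s a"
proof -
  have "sat I (history_fm m (s, a)) \<longleftrightarrow>
      (\<forall>i<m. sat I (at_time i (s i)) \<and> sat I (at_time i (a i))) \<and> sat I (at_time m (s m))"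
    unfolding history_fm_def by auto
  also have "\<dots> \<longleftrightarrow> (\<forall>i\<le>m. sat I (at_time i (s i))) \<and> (\<forall>i<m. sat I (at_time i (a i)))"
    by (auto simp: le_less)
  also have "\<dots> \<longleftrightarrow> I \<in> runs b m s a"
    using sat_at_time_state[OF I] sat_at_time_action[OF I] s a I unfolding runs_def by auto
  finally show ?thesis .
qed

end

section \<open>Probabilities and expectations as quotients of weights\<close>

lemma prob_eq: "prob \<Pi> F = (\<Sum>I | I \<in> SM \<Pi> \<and> sat I F. weight_of \<Pi> I) / (\<Sum>I\<in>SM \<Pi>. weight_of \<Pi> I)"
  unfolding prob_def prob_int_def sum_divide_distrib ..

lemma sum_weight_pos:
  assumes "finite (SM \<Pi>)" "(\<Sum>I | I \<in> SM \<Pi> \<and> sat I F. weight_of \<Pi> I) \<noteq> 0"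
  shows "0 < (\<Sum>I\<in>SM \<Pi>. weight_of \<Pi> I)"
proof -
  have "SM \<Pi> \<noteq> {}" using assms(2) by auto
  then show ?thesis using assms(1) by (intro sum_pos) (auto simp: weight_of_def)
qed

text \<open>The normalising sum vanishes only if there are no stable models, and then both sides are
  empty sums.\<close>

lemma prob_eq_0_iff:
  assumes "finite (SM \<Pi>)"
  shows "prob \<Pi> F = 0 \<longleftrightarrow> (\<Sum>I | I \<in> SM \<Pi> \<and> sat I F. weight_of \<Pi> I) = 0"
proof (cases "(\<Sum>I | I \<in> SM \<Pi> \<and> sat I F. weight_of \<Pi> I) = 0")
  case True
  then show ?thesis unfolding prob_eq by simp
next
  case False
  then show ?thesis using sum_weight_pos[OF assms False] unfolding prob_eq by simp
qed

lemma cond_prob_eq: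
  assumes "finite (SM \<Pi>)" "(\<Sum>I | I \<in> SM \<Pi> \<and> sat I G. weight_of \<Pi> I) \<noteq> 0"
  shows "cond_prob \<Pi> F G = Some ((\<Sum>I | I \<in> SM \<Pi> \<and> sat I (And F G). weight_of \<Pi> I)
     / (\<Sum>I | I \<in> SM \<Pi> \<and> sat I G. weight_of \<Pi> I))"
  using sum_weight_pos[OF assms] assms prob_eq_0_iff[OF assms(1), of G]
  unfolding cond_prob_def unfolding prob_eq by simp

text \<open>The constant leaves the sum, and the remaining conditional probabilities add up to 1
  whenever they are defined.\<close>

lemma expected_utility_const:
  assumes "finite (SM \<Pi>)" "\<And>I. I \<in> SM \<Pi> \<Longrightarrow> sat I F \<Longrightarrow> utility I = k"
  shows "expected_utility \<Pi> F =
    (if (\<Sum>I | I \<in> SM \<Pi> \<and> sat I F. weight_of \<Pi> I) = 0 then None else Some k)"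
proof (cases "prob \<Pi> F = 0")
  case True
  then show ?thesis using prob_eq_0_iff[OF assms(1)] unfolding expected_utility_def by simp
next
  case False
  have "(\<Sum>I | I \<in> SM \<Pi> \<and> sat I F. utility I * (prob_int \<Pi> I / prob \<Pi> F)) =
      (\<Sum>I | I \<in> SM \<Pi> \<and> sat I F. k / prob \<Pi> F * prob_int \<Pi> I)"
    using assms(2) by (intro sum.cong) auto
  also have "\<dots> = k / prob \<Pi> F * prob \<Pi> F" unfolding sum_distrib_left[symmetric] prob_def ..
  finally show ?thesis
    using False prob_eq_0_iff[OF assms(1)] unfolding expected_utility_def by simp
qed

lemma those_map:
  "those (map f xs) = (if \<forall>x\<in>set xs. f x \<noteq> None then Some (map (\<lambda>x. the (f x)) xs) else None)"
  by (induction xs) (auto split: option.splits)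

section \<open>The decision process and the histories evaluated by step weights\<close>

context action_theory
begin

text \<open>The models of the condition are the runs of a one-step history. They share one utility,
  and their total weight is the step weight because the base weight is 1.\<close>

lemma MDP_reward:
  assumes s: "s \<in> states D" "s' \<in> states D" and a: "a \<in> actions D"
  shows "mdp_R (MDP D) s a s' = (if step_weight s a s' = 0 then None else Some (step_reward s a s'))"
proof -
  let ?F = "And (And (at_time 0 s) (at_time 0 a)) (at_time 1 s')"
  let ?s = "\<lambda>i :: nat. if i = 0 then s else s'" and ?a = "\<lambda>i :: nat. a"
  have R: "sat I ?F \<longleftrightarrow> I \<in> runs False (Suc 0) ?s ?a" if "I \<in> SM (prog False (Suc 0))" for I
    using sat_at_time_state[OF that, of 0 s] sat_at_time_state[OF that, of 1 s']
      sat_at_time_action[OF that, of 0 a] s a that unfolding runs_def by (auto simp: le_Suc_eq)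
  then have S: "{I. I \<in> SM (prog False (Suc 0)) \<and> sat I ?F} = runs False (Suc 0) ?s ?a"
    using runs_SM by blast
  have "runs False 0 ?s ?a = {I \<in> SM (prog False 0). part D (fl D) I 0 = s}"
    unfolding runs_def by auto
  then have W: "total_weight False (Suc 0) (runs False (Suc 0) ?s ?a) = step_weight s a s'"
    using total_weight_runs_Suc[of False 0 ?s ?a] total_weight_base[OF s(1)] by simp
  have "expected_utility (prog False (Suc 0)) ?F = (if step_weight s a s' = 0 then None else Some (step_reward s a s'))"
    unfolding W[symmetric] total_weight_def S[symmetric]
    by (rule expected_utility_const[OF finite_SM_prog])
      (use R utility_runs[of _ False "Suc 0" ?s ?a] in auto)
  then show ?thesis unfolding MDP_def D_m_eq by simp
qed

lemma MDP_transition: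
  assumes sa: "standing_assumptions D" and s: "s \<in> states D" "s' \<in> states D" and a: "a \<in> actions D"
  shows "mdp_T (MDP D) s a s' = Some (step_weight s a s' / total_pweight)"
proof -
  let ?G = "And (at_time 0 s) (at_time 0 a)" and ?F = "at_time 1 s'"
  \<comment> \<open>The constant policy turns conditioning on the state and the action at time 0
    into an instance of policy runs.\<close>
  let ?s = "\<lambda>i :: nat. if i = 0 then s else s'" and ?a = "\<lambda>i :: nat. a" and ?\<pi> = "\<lambda>s (i :: nat). a"
  have "sat I (And ?F ?G) \<longleftrightarrow> I \<in> runs False (Suc 0) ?s ?a" if "I \<in> SM (prog False (Suc 0))" for I
    using sat_at_time_state[OF that, of 0 s] sat_at_time_state[OF that, of 1 s']
      sat_at_time_action[OF that, of 0 a] s a that unfolding runs_def by (auto simp: le_Suc_eq)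
  then have S: "{I. I \<in> SM (prog False (Suc 0)) \<and> sat I (And ?F ?G)} = runs False (Suc 0) ?s ?a"
    using runs_SM by blast
  have "sat I ?G \<longleftrightarrow> I \<in> policy_runs False (Suc 0) s ?\<pi>" if "I \<in> SM (prog False (Suc 0))" for I
    using sat_at_time_state[OF that, of 0 s] sat_at_time_action[OF that, of 0 a] s a that
    unfolding policy_runs_def by auto
  then have S': "{I. I \<in> SM (prog False (Suc 0)) \<and> sat I ?G} = policy_runs False (Suc 0) s ?\<pi>"
    using policy_runs_SM by blast
  have "runs False 0 ?s ?a = {I \<in> SM (prog False 0). part D (fl D) I 0 = s}"
    "policy_runs False 0 s ?\<pi> = {I \<in> SM (prog False 0). part D (fl D) I 0 = s}"
    unfolding runs_def policy_runs_def by auto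
  then have W: "total_weight False (Suc 0) (runs False (Suc 0) ?s ?a) = step_weight s a s'"
    "total_weight False (Suc 0) (policy_runs False (Suc 0) s ?\<pi>) = total_pweight"
    using total_weight_runs_Suc[of False 0 ?s ?a] total_weight_policy_runs[OF sa, of "Suc 0" ?\<pi> False s]
      total_weight_base[OF s(1)] a by simp_all
  have "cond_prob (prog False (Suc 0)) ?F ?G = Some (step_weight s a s' / total_pweight)"
    using cond_prob_eq[OF finite_SM_prog, of False "Suc 0" ?G ?F] W total_pweight_pos
    unfolding total_weight_def S S' by simp
  then show ?thesis unfolding MDP_def D_m_eq by simp
qed

text \<open>Weights are exponentials, so a single stable model suffices. The factor can then be
  cancelled, and a history of weight 0 must have a step of weight 0.\<close>

lemma initial_weight_pos:
  assumes "consistent_init D (s 0)" "s 0 \<in> states D"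
  shows "0 < total_weight True 0 (runs True 0 s a)"
proof -
  obtain I where I: "I \<in> SM (prog True 0)" "sat I (at_time 0 (s 0))"
    using assms(1) unfolding consistent_init_def init_eq by blast
  then have "part D (fl D) I 0 = s 0" using sat_at_time_state[OF I(1)] assms(2) by simp
  then have "runs True 0 s a \<noteq> {}" using I(1) unfolding runs_def by auto
  moreover have "finite (runs True 0 s a)"
    by (rule finite_subset[OF _ finite_SM_prog[of True 0]]) (auto simp: runs_def)
  ultimately show ?thesis unfolding total_weight_def
    by (intro sum_pos) (auto simp: runs_def intro: weight_pos)
qed

text \<open>Both sides are undefined exactly if some step weight vanishes; otherwise both are the
  sum of the step rewards.\<close>

lemma history_reward:
  assumes s: "\<forall>i\<le>m. s i \<in> states D" and a: "\<forall>i<m. a i \<in> actions D"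
    and c: "consistent_init D (s 0)"
  shows "total_reward D m (s, a) = mdp_reward (MDP D) m (s, a)"
proof -
  let ?q = "\<lambda>i. step_weight (s i) (a i) (s (Suc i))" and ?r = "\<lambda>i. step_reward (s i) (a i) (s (Suc i))"
  have S: "{I. I \<in> SM (prog True m) \<and> sat I (history_fm m (s, a))} = runs True m s a"
    using sat_history_fm[OF _ s a] runs_SM by blast
  have "total_weight True m (runs True m s a) = 0 \<longleftrightarrow> (\<exists>i<m. ?q i = 0)"
    using initial_weight_pos[where s = s and a = a, OF c] s unfolding total_weight_runs[of True m] by auto
  moreover have "expected_utility (prog True m) (history_fm m (s, a)) =
      (if total_weight True m (runs True m s a) = 0 then None else Some (\<Sum>i<m. ?r i))"
    unfolding total_weight_def S[symmetric]
    by (rule expected_utility_const[OF finite_SM_prog])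
      (use sat_history_fm[OF _ s a] utility_runs in blast)
  ultimately have L: "total_reward D m (s, a) = (if \<exists>i<m. ?q i = 0 then None else Some (\<Sum>i<m. ?r i))"
    unfolding total_reward_def Tr_eq by simp
  have R: "mdp_R (MDP D) (s i) (a i) (s (i + 1)) = (if ?q i = 0 then None else Some (?r i))" if "i < m" for i
    using MDP_reward[of "s i" "s (Suc i)" "a i"] s a that by simp
  have "mdp_reward (MDP D) m (s, a) = (if \<exists>i<m. ?q i = 0 then None else
      Some (\<Sum>i\<leftarrow>[0..<m]. the (mdp_R (MDP D) (s i) (a i) (s (i + 1)))))"
    unfolding mdp_reward_def those_map using R by auto
  moreover have "(\<Sum>i\<leftarrow>[0..<m]. the (mdp_R (MDP D) (s i) (a i) (s (i + 1)))) = (\<Sum>i<m. ?r i)"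
    if "\<not> (\<exists>i<m. ?q i = 0)"
    using R that by (simp add: interv_sum_list_conv_sum_set_nat atLeast0LessThan)
  ultimately show ?thesis unfolding L by auto
qed

text \<open>An explicit common value \<open>p\<close> also shows that both sides are defined: it may
  be 0, but the condition and \<open>total_pweight\<close> have positive weight.\<close>

lemma history_prob:
  assumes sa: "standing_assumptions D" and s: "\<forall>i\<le>m. s i \<in> states D"
    and \<pi>: "\<forall>t\<in>states D. \<forall>i<m. \<pi> t i \<in> actions D" and c: "consistent_init D (s 0)"
  defines "p \<equiv> \<Prod>i<m. step_weight (s i) (\<pi> (s i) i) (s (Suc i)) / total_pweight"
  shows "cond_prob (Tr D m) (seq_fm m s) (And (seq_fm 0 s) (policy_fm D \<pi> m)) = Some p"
    and "mdp_prob (MDP D) m (s, \<lambda>i. \<pi> (s i) i) = Some p"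
proof -
  let ?a = "\<lambda>i. \<pi> (s i) i" and ?G = "And (seq_fm 0 s) (policy_fm D \<pi> m)"
  let ?q = "\<lambda>i. step_weight (s i) (?a i) (s (Suc i))"
  have s0: "\<forall>i\<le>0. s i \<in> states D" using s by simp
  have "sat I ?G \<longleftrightarrow> I \<in> policy_runs True m (s 0) \<pi>" if "I \<in> SM (prog True m)" for I
    using sat_seq_fm[OF that _ s0] sat_policy_fm[OF that \<pi>] that unfolding policy_runs_def by simp
  then have SG: "{I. I \<in> SM (prog True m) \<and> sat I ?G} = policy_runs True m (s 0) \<pi>"
    using policy_runs_SM by blast
  have "sat I (And (seq_fm m s) ?G) \<longleftrightarrow> I \<in> runs True m s ?a" if "I \<in> SM (prog True m)" for I
    using sat_seq_fm[OF that _ s0] sat_seq_fm[OF that _ s] sat_policy_fm[OF that \<pi>] that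
    unfolding runs_def by auto
  then have SF: "{I. I \<in> SM (prog True m) \<and> sat I (And (seq_fm m s) ?G)} = runs True m s ?a"
    using runs_SM by blast
  let ?w = "total_weight True 0 (runs True 0 s ?a)"
  have w: "0 < ?w" using initial_weight_pos[where s = s and a = ?a, OF c] s by simp
  have "policy_runs True 0 (s 0) \<pi> = runs True 0 s ?a" unfolding policy_runs_def runs_def by auto
  then have G: "total_weight True m (policy_runs True m (s 0) \<pi>) = ?w * total_pweight ^ m"
    using total_weight_policy_runs[OF sa \<pi>, of True "s 0"] by simp
  then have G0: "total_weight True m (policy_runs True m (s 0) \<pi>) \<noteq> 0"
    using w total_pweight_pos by simp
  have "cond_prob (prog True m) (seq_fm m s) ?G =
      Some (total_weight True m (runs True m s ?a) / total_weight True m (policy_runs True m (s 0) \<pi>))"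
    using cond_prob_eq[OF finite_SM_prog, of True m ?G "seq_fm m s"] G0
    unfolding total_weight_def SG SF by simp
  \<comment> \<open>The initial weight cancels, and the power of \<open>total_pweight\<close>
    supplies one denominator for each of the \<open>m\<close> factors.\<close>
  moreover have "total_weight True m (runs True m s ?a) / total_weight True m (policy_runs True m (s 0) \<pi>) = p"
    unfolding G total_weight_runs[of True m] p_def prod_dividef using w by simp
  ultimately show "cond_prob (Tr D m) (seq_fm m s) ?G = Some p" unfolding Tr_eq by simp
  have T: "mdp_T (MDP D) (s i) (?a i) (s (i + 1)) = Some (?q i / total_pweight)" if "i < m" for i
    using MDP_transition[OF sa, of "s i" "s (Suc i)" "?a i"] s \<pi> that by simp
  then have "mdp_prob (MDP D) m (s, ?a) =
      Some (\<Prod>i\<leftarrow>[0..<m]. the (mdp_T (MDP D) (s i) (?a i) (s (i + 1))))"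
    unfolding mdp_prob_def those_map by auto
  also have "(\<Prod>i\<leftarrow>[0..<m]. the (mdp_T (MDP D) (s i) (?a i) (s (i + 1)))) = p"
    using T unfolding p_def by (subst prod.distinct_set_conv_list[symmetric]) (auto intro!: prod.cong)
  finally show "mdp_prob (MDP D) m (s, ?a) = Some p" .
qed

end

text \<open>The reward equation is between options, since a policy history may contain an impossible
  step and then both sides are \<open>None\<close>; the probability equation is between defined
  values.\<close>

theorem theorem3:
  fixes D :: "('c, 'v) action_desc" and m :: nat
    and \<pi> :: "('c, 'v) assign \<Rightarrow> nat \<Rightarrow> ('c, 'v) assign"
    and s :: "nat \<Rightarrow> ('c, 'v) assign"
  assumes "action_description D"
    and "standing_assumptions D"
    and "\<forall>i\<le>m. s i \<in> states D"
    and "consistent_init D (s 0)"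
    and "\<forall>t \<in> states D. \<forall>i<m. \<pi> t i \<in> actions D"
  shows "total_reward D m (policy_history \<pi> s) = mdp_reward (MDP D) m (policy_history \<pi> s)
     \<and> (\<exists>p. cond_prob (Tr D m) (seq_fm m s) (And (seq_fm 0 s) (policy_fm D \<pi> m)) = Some p
          \<and> mdp_prob (MDP D) m (policy_history \<pi> s) = Some p)"
proof -
  interpret action_theory D by (unfold_locales) (rule assms(1))
  have "\<forall>i<m. \<pi> (s i) i \<in> actions D" using assms(3,5) by simp
  then have "total_reward D m (policy_history \<pi> s) = mdp_reward (MDP D) m (policy_history \<pi> s)"
    unfolding policy_history_def by (rule history_reward[OF assms(3) _ assms(4)])
  moreover note history_prob[OF assms(2,3,5,4)]
  ultimately show ?thesis unfolding policy_history_def by blast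
qed

end
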